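(* Let $\{x(t)\}_{t\ge 1}$ be the iterates of the stochastic mirror descent algorithm $$x(t+1)=\operatorname*{arg\,min}_{x\in\mathbb{X}}\Big\{\langle \tilde g(t),x-x(t)\rangle+\frac{1}{\alpha(t)}\mathbb{D}_R(x,x(t))\Big\},\qquad t\ge 1,$$ for the problem $\min_{x\in\mathbb{X}}f(x)$, under Assumptions A1, A2, A3 of the context, and let $z(t)=\big(\sum_{k=1}^t\alpha(k)\big)^{-1}\sum_{j=1}^t\alpha(j)x(j)$. Then for every $\epsilon>0$ there exists $t_0\in\mathbb{N}$ such that for all $t\ge t_0$ $$\mathbb{P}\big(f(z(t))-f^\ast\ge\epsilon\big)\le\frac{3\nu^2\sum_{k=1}^t\alpha(k)^2}{2\sigma_R\,\epsilon\,\mathrm{K}\sum_{k=1}^t\alpha(k)}+\frac{9D^2\kappa_1\sum_{k=1}^t\alpha(k)^2\big(\nu^2+G^2+B(k)^2\big)}{\epsilon^2\,\mathrm{K}^2\big(\sum_{k=1}^t\alpha(k)\big)^2},$$ where $\mathrm{K}=\exp\big(-\sum_{k=1}^\infty \frac{2\alpha(k)B(k)}{\sigma_R}\big)$.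
   Context: Setting. $\|\cdot\|$ is an arbitrary norm on $\mathbb{R}^n$, $\|x\|_\ast=\sup\{\langle x,y\rangle:\|y\|\le 1\}$ its dual norm. $\mathbb{X}\subseteq\mathbb{R}^n$ is nonempty, convex and compact with diameter $D=\sup_{x,y\in\mathbb{X}}\|x-y\|$. $f:\mathbb{R}^n\to\mathbb{R}$ is convex (and continuous), $f^\ast=\min_{x\in\mathbb{X}}f(x)$. $G>0$ is a constant with $\|g\|_\ast\le G$ for all $g\in\partial f(x)$ and all $x\in\mathbb{X}$. Bregman divergence. $R$ is $\sigma_R$-strongly convex with respect to $\|\cdot\|$ ($\sigma_R>0$) and differentiable on an open set containing $\mathbb{X}$, and $\mathbb{D}_R(x,y)=R(x)-R(y)-\langle\nabla R(y),x-y\rangle$ for $x,y\in\mathbb{X}$. Algorithm. $x(1)\in\mathbb{X}$ is the initial point, $\alpha(t)>0$ are deterministic step-sizes, and $\tilde g(t)$ is a random vector (a noisy subgradient of $f$ at $x(t)$). $\mathcal{F}_t=\sigma(x(1),\dots,x(t))$. Assumption A1. $\mathbb{E}[\tilde g(t)\mid\mathcal{F}_t]=g(t)+b(t)$ a.s., where $g(t)\in\partial f(x(t))$ is a subgradient of $f$ at $x(t)$ and $b(t)$ is an $\mathcal{F}_t$-measurable random vector (the bias); and $\mathbb{E}[\|\tilde g(t)\|_\ast^2\mid\mathcal{F}_t]\le\nu^2$ a.s. for all $t$, for a constant $\nu$. Assumption A2. $\sum_{t\ge1}\alpha(t)=\infty$ and $\sum_{t\ge1}\alpha(t)^2<\infty$.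 Assumption A3. $B(t)\ge 0$ are deterministic numbers with $\|b(t)\|_\ast\le B(t)$ a.s. for all $t$, and $\sum_{t\ge1}\alpha(t)B(t)<\infty$. Constant $\kappa_1$. $\kappa_1>0$ is a constant such that $\|u+v+w\|_\ast^2\le\kappa_1(\|u\|_\ast^2+\|v\|_\ast^2+\|w\|_\ast^2)$ for all $u,v,w\in\mathbb{R}^n$. *)

theory Defs
  imports "HOL-Probability.Probability"
begin

definition is_norm :: "('a::real_vector \<Rightarrow> real) \<Rightarrow> bool" where
  "is_norm N \<longleftrightarrow>
     (\<forall>x. 0 \<le> N x) \<and> (\<forall>x. N x = 0 \<longleftrightarrow> x = 0) \<and>
     (\<forall>c x. N (c *\<^sub>R x) = \<bar>c\<bar> * N x) \<and> (\<forall>x y. N (x + y) \<le> N x + N y)"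

definition dual_norm :: "('a::real_inner \<Rightarrow> real) \<Rightarrow> 'a \<Rightarrow> real" where
  "dual_norm N x = (SUP y\<in>{y. N y \<le> 1}. x \<bullet> y)"

definition norm_diameter :: "('a::real_vector \<Rightarrow> real) \<Rightarrow> 'a set \<Rightarrow> real" where
  "norm_diameter N S = (SUP (x, y)\<in>S \<times> S. N (x - y))"

definition subdifferential :: "('a::real_inner \<Rightarrow> real) \<Rightarrow> 'a \<Rightarrow> 'a set" where
  "subdifferential f x = {g. \<forall>y. f x + g \<bullet> (y - x) \<le> f y}"

text \<open>As with the library's \<^const>\<open>convex_on\<close>, convexity of the domain is part of the notion.\<close>

definition strongly_convex_on ::
    "('a::real_vector \<Rightarrow> real) \<Rightarrow> real \<Rightarrow> 'a set \<Rightarrow> ('a \<Rightarrow> real) \<Rightarrow> bool" where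
  "strongly_convex_on N \<sigma> S R \<longleftrightarrow>
     convex S \<and>
     (\<forall>x\<in>S. \<forall>y\<in>S. \<forall>u\<ge>0. \<forall>v\<ge>0. u + v = 1 \<longrightarrow>
        R (u *\<^sub>R x + v *\<^sub>R y) \<le> u * R x + v * R y - \<sigma> / 2 * u * v * (N (x - y))\<^sup>2)"

text \<open>Meaningful only at points where the function is differentiable.\<close>

definition gradient :: "('a::real_inner \<Rightarrow> real) \<Rightarrow> 'a \<Rightarrow> 'a" where
  "gradient R y = (THE D. GDERIV R y :> D)"

definition bregman :: "('a::real_inner \<Rightarrow> real) \<Rightarrow> 'a \<Rightarrow> 'a \<Rightarrow> real" where
  "bregman R x y = R x - R y - gradient R y \<bullet> (x - y)"

definition history ::
    "'w measure \<Rightarrow> (nat \<Rightarrow> 'w \<Rightarrow> 'a::topological_space) \<Rightarrow> nat \<Rightarrow> 'w measure" where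
  "history M x t = sigma (space M) {x s -` A \<inter> space M | s A. s \<in> {1..t} \<and> A \<in> sets borel}"

definition vec_cond_exp ::
    "'w measure \<Rightarrow> 'w measure \<Rightarrow> ('w \<Rightarrow> real ^ 'n) \<Rightarrow> 'w \<Rightarrow> real ^ 'n" where
  "vec_cond_exp M F Y \<omega> = (\<chi> i. real_cond_exp M F (\<lambda>\<omega>'. Y \<omega>' $ i) \<omega>)"

definition weighted_average ::
    "(nat \<Rightarrow> real) \<Rightarrow> (nat \<Rightarrow> 'w \<Rightarrow> 'a::real_vector) \<Rightarrow> nat \<Rightarrow> 'w \<Rightarrow> 'a" where
  "weighted_average \<alpha> x t \<omega> = inverse (\<Sum>k=1..t. \<alpha> k) *\<^sub>R (\<Sum>j=1..t. \<alpha> j *\<^sub>R x j \<omega>)"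

text \<open>
  Second moments are conditioned with \<^const>\<open>nn_cond_exp\<close>: an \<^typ>\<open>ennreal\<close>-valued bound forces
  them to be finite, whereas \<^const>\<open>real_cond_exp\<close> takes arbitrary values on non-integrable functions.
\<close>

definition cond_second_moment_le ::
    "'w measure \<Rightarrow> 'w measure \<Rightarrow> ('a::euclidean_space \<Rightarrow> real) \<Rightarrow> ('w \<Rightarrow> 'a) \<Rightarrow> real \<Rightarrow> bool" where
  "cond_second_moment_le M F N Y c \<longleftrightarrow>
     (AE \<omega> in M. nn_cond_exp M F (\<lambda>\<omega>'. ennreal ((N (Y \<omega>'))\<^sup>2)) \<omega> \<le> ennreal c)"

end

theory Submission
  imports Defs
begin

text \<open>
  Write \<open>x\<^sub>*\<close> for a minimizer of \<open>f\<close> on \<open>X\<close> and \<open>A\<^sub>t\<close> for the sum of the first \<open>t\<close> step sizes.  One mirror step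
  satisfies the pathwise inequality
  \<open>\<alpha>(t) \<langle>gt(t), x(t) - x\<^sub>*\<rangle> \<le> D\<^sub>R(x\<^sub>*, x(t)) - D\<^sub>R(x\<^sub>*, x(t+1)) + \<alpha>(t)\<^sup>2 \<parallel>gt(t)\<parallel>\<^sub>*\<^sup>2 / (2\<sigma>)\<close>
  (\<open>mirror_step_descent\<close>).  Summed over time the divergences telescope to something bounded uniformly
  in the outcome, and the left side splits into the predictable part, which dominates the
  suboptimality up to the bias \<open>\<alpha>(t) B(t) D\<close>, and a centered noise term.  By convexity,
  \<open>A\<^sub>t (f(z(t)) - f(x\<^sub>*))\<close> is at most a constant, plus the weighted sum of second moments, plus a
  centered sum.  Once \<open>A\<^sub>t\<close> is so large that the constant is below \<open>\<epsilon> A\<^sub>t / 3\<close>, a deviation of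
  size \<open>\<epsilon>\<close> forces one of the two random terms to reach \<open>\<epsilon> A\<^sub>t / 3\<close>.  Markov's inequality for the
  first and Chebyshev's for the second give the two summands of the bound with \<open>1\<close> in place of \<open>K\<close>
  (\<open>tail_bound\<close>), and dividing by \<open>K \<le> 1\<close> only enlarges them.

  One point needs care.  The history \<open>\<F>\<^sub>t\<close> is generated by the iterates alone, and a step that is
  clipped at the boundary of \<open>X\<close> does not reveal the noise that produced it.  Hence the past noise
  \<open>\<langle>gt(s) - E[gt(s)|\<F>\<^sub>s], x(s) - x\<^sub>*\<rangle>\<close>, \<open>s < t\<close>, need not be \<open>\<F>\<^sub>t\<close>-measurable, and the noise terms
  need not be orthogonal.  The remedy is to take the conditional expectation of the pathwise
  inequality given \<open>\<F>\<^sub>t\<^sub>+\<^sub>1\<close> (\<open>visible_descent\<close>): the divergences are \<open>\<F>\<^sub>t\<^sub>+\<^sub>1\<close>-measurable and stay as they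
  are, while the noise is replaced by its projection onto \<open>\<F>\<^sub>t\<^sub>+\<^sub>1\<close>.  These projections are genuine
  martingale differences, and by Jensen's inequality their second moments do not grow.

  Conditioning requires the iterates, which are only specified as minimizers, to be random variables:
  the minimizer of a mirror step is a Lipschitz function of the dual point \<open>\<alpha>(t) gt(t) - \<nabla>R(x(t))\<close>
  by strong convexity, and \<open>\<nabla>R\<close> is a pointwise limit of difference quotients.
\<close>

section \<open>Norms and their duals\<close>

lemma is_normD:
  assumes "is_norm N"
  shows is_norm_nonneg: "0 \<le> N x" and is_norm_eq_0: "N x = 0 \<longleftrightarrow> x = 0"
    and is_norm_scale: "N (c *\<^sub>R x) = \<bar>c\<bar> * N x" and is_norm_triangle: "N (x + y) \<le> N x + N y"
  using assms unfolding is_norm_def by blast+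

lemma is_norm_minus: "is_norm N \<Longrightarrow> N (- x) = N x"
  using is_norm_scale[of N "-1" x] by simp

text \<open>
  All norms on a Euclidean space are equivalent; the two inequalities transfer continuity,
  measurability and integrability between an arbitrary norm and the Euclidean one.
\<close>
lemma is_norm_le_norm:
  fixes N :: "'a::euclidean_space \<Rightarrow> real"
  assumes N: "is_norm N"
  obtains C where "C > 0" "\<And>x. N x \<le> C * norm x"
proof
  let ?C = "1 + (\<Sum>i\<in>Basis. N i)"
  show "?C > 0" using is_norm_nonneg[OF N] by (smt (verit) sum_nonneg)
  fix x :: 'a
  have sub: "N (sum h A) \<le> (\<Sum>i\<in>A. N (h i))" if "finite A" for A :: "'a set" and h
    using that
  proof (induction A rule: finite_induct)
    case empty
    then show ?case using is_norm_eq_0[OF N, of 0] by simp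
  next
    case (insert a A)
    then show ?case using is_norm_triangle[OF N, of "h a" "sum h A"] by simp
  qed
  have "N x = N (\<Sum>i\<in>Basis. (x \<bullet> i) *\<^sub>R i)" by (simp add: euclidean_representation)
  also have "\<dots> \<le> (\<Sum>i\<in>Basis. N ((x \<bullet> i) *\<^sub>R i))" by (rule sub) simp
  also have "\<dots> \<le> (\<Sum>i\<in>Basis. norm x * N i)"
    by (intro sum_mono) (simp add: is_norm_scale[OF N] Basis_le_norm mult_right_mono is_norm_nonneg[OF N])
  also have "\<dots> = (\<Sum>i\<in>Basis. N i) * norm x" by (simp add: sum_distrib_left mult.commute[of _ "norm x"])
  also have "\<dots> \<le> ?C * norm x" by (simp add: distrib_right)
  finally show "N x \<le> ?C * norm x" .
qed

lemma is_norm_continuous: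
  fixes N :: "'a::euclidean_space \<Rightarrow> real"
  assumes N: "is_norm N"
  shows "continuous_on S N"
proof -
  obtain C where C: "C > 0" "\<And>x. N x \<le> C * norm x" using is_norm_le_norm[OF N] by blast
  have "\<bar>N x - N y\<bar> \<le> C * norm (x - y)" for x y
    using is_norm_triangle[OF N, of "x - y" y] is_norm_triangle[OF N, of "y - x" x]
      is_norm_minus[OF N, of "x - y"] C(2)[of "x - y"] by simp
  then have "C-lipschitz_on S N"
    using C(1) by (intro lipschitz_onI) (auto simp: dist_norm)
  then show ?thesis by (rule lipschitz_on_continuous_on)
qed

text \<open>By compactness a norm has a positive minimum on the Euclidean unit sphere; then rescale.\<close>
lemma norm_le_is_norm:
  fixes N :: "'a::euclidean_space \<Rightarrow> real"
  assumes N: "is_norm N"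
  obtains C where "C > 0" "\<And>x. norm x \<le> C * N x"
proof -
  have "compact (sphere (0::'a) 1)" "sphere (0::'a) 1 \<noteq> {}" by auto
  then obtain u where u: "u \<in> sphere 0 1" "\<And>y. y \<in> sphere 0 1 \<Longrightarrow> N u \<le> N y"
    using continuous_attains_inf[OF _ _ is_norm_continuous[OF N], of "sphere 0 1"] by blast
  have Nu: "N u > 0"
    using u(1) is_norm_nonneg[OF N, of u] is_norm_eq_0[OF N, of u] by (cases "u = 0") auto
  have "norm x \<le> inverse (N u) * N x" for x
  proof (cases "x = 0")
    case False
    then have "N u \<le> N (inverse (norm x) *\<^sub>R x)" by (intro u(2)) simp
    then show ?thesis using False Nu by (simp add: is_norm_scale[OF N] field_simps)
  qed (simp add: is_norm_nonneg[OF N] Nu less_imp_le)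
  then show thesis using that Nu by (meson positive_imp_inverse_positive)
qed

context
  fixes N :: "'a::euclidean_space \<Rightarrow> real"
  assumes N: "is_norm N"
begin

text \<open>The unit ball of \<open>N\<close> is bounded, so the supremum defining the dual norm is a genuine one.\<close>
lemma dual_norm_upper:
  assumes "N y \<le> 1"
  shows "x \<bullet> y \<le> dual_norm N x"
proof -
  obtain C where C: "C > 0" "\<And>x. norm x \<le> C * N x" using norm_le_is_norm[OF N] by blast
  have "x \<bullet> z \<le> norm x * C" if "N z \<le> 1" for z
    using that C norm_cauchy_schwarz[of x z]
    by (smt (verit, best) mult_left_le mult_left_mono norm_ge_zero)
  then have "bdd_above ((\<lambda>y. x \<bullet> y) ` {y. N y \<le> 1})" by (auto intro!: bdd_aboveI2)
  then show ?thesis unfolding dual_norm_def using assms by (auto intro: cSUP_upper)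
qed

lemma dual_norm_least:
  assumes "\<And>y. N y \<le> 1 \<Longrightarrow> x \<bullet> y \<le> c"
  shows "dual_norm N x \<le> c"
  unfolding dual_norm_def
proof (rule cSUP_least)
  have "N 0 \<le> 1" using is_norm_eq_0[OF N, of 0] by simp
  then show "{y. N y \<le> 1} \<noteq> {}" by blast
qed (use assms in auto)

lemma dual_norm_nonneg: "0 \<le> dual_norm N x"
  using dual_norm_upper[of 0 x] is_norm_eq_0[OF N, of 0] by simp

lemma inner_le_dual_norm: "x \<bullet> y \<le> dual_norm N x * N y"
proof (cases "y = 0")
  case False
  then have Ny: "N y > 0"
    using is_norm_nonneg[OF N, of y] is_norm_eq_0[OF N, of y] by linarith
  have "x \<bullet> (inverse (N y) *\<^sub>R y) \<le> dual_norm N x"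
    by (rule dual_norm_upper) (use Ny in \<open>simp add: is_norm_scale[OF N]\<close>)
  then show ?thesis using Ny by (simp add: field_simps)
qed (use is_norm_eq_0[OF N, of 0] in simp)

lemma dual_norm_minus: "dual_norm N (- x) = dual_norm N x"
proof (rule antisym; rule dual_norm_least)
  show "- x \<bullet> y \<le> dual_norm N x" if "N y \<le> 1" for y
    using dual_norm_upper[of "- y" x] that by (simp add: is_norm_minus[OF N])
  show "x \<bullet> y \<le> dual_norm N (- x)" if "N y \<le> 1" for y
    using dual_norm_upper[of "- y" "- x"] that by (simp add: is_norm_minus[OF N])
qed

lemma abs_inner_le_dual_norm: "\<bar>x \<bullet> y\<bar> \<le> dual_norm N x * N y"
  using inner_le_dual_norm[of x y] inner_le_dual_norm[of x "- y"]
  by (simp add: is_norm_minus[OF N] abs_le_iff)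

lemma dual_norm_is_norm: "is_norm (dual_norm N)"
proof -
  have tri: "dual_norm N (x + y) \<le> dual_norm N x + dual_norm N y" for x y
    by (rule dual_norm_least) (simp add: inner_add_left add_mono dual_norm_upper)
  have scale_le: "dual_norm N (c *\<^sub>R x) \<le> \<bar>c\<bar> * dual_norm N x" for c x
  proof (rule dual_norm_least)
    fix y assume "N y \<le> 1"
    then have "\<bar>x \<bullet> y\<bar> \<le> dual_norm N x"
      using abs_inner_le_dual_norm[of x y] dual_norm_nonneg[of x]
      by (meson mult_left_le order_trans)
    then have "\<bar>c\<bar> * \<bar>x \<bullet> y\<bar> \<le> \<bar>c\<bar> * dual_norm N x" by (rule mult_left_mono) simp
    then show "c *\<^sub>R x \<bullet> y \<le> \<bar>c\<bar> * dual_norm N x"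
      by (metis abs_mult abs_le_D1 inner_scaleR_left)
  qed
  have scale: "dual_norm N (c *\<^sub>R x) = \<bar>c\<bar> * dual_norm N x" for c x
  proof (cases "c = 0")
    case True
    then show ?thesis using scale_le[of c x] dual_norm_nonneg[of "c *\<^sub>R x"] by simp
  next
    case False
    then show ?thesis using scale_le[of c x] scale_le[of "inverse c" "c *\<^sub>R x"]
      by (simp add: field_simps)
  qed
  have zero: "x = 0" if "dual_norm N x = 0" for x
    using inner_le_dual_norm[of x x] inner_ge_zero[of x] inner_eq_zero_iff[of x] that
    by (metis mult_zero_left order_antisym)
  show ?thesis
    unfolding is_norm_def using tri scale zero dual_norm_nonneg scale[of 0] by auto
qed

lemma dual_norm_measurable [measurable]: "dual_norm N \<in> borel_measurable borel"
  by (intro borel_measurable_continuous_onI is_norm_continuous dual_norm_is_norm)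

end

lemma norm_diameter_upper:
  fixes N :: "'a::euclidean_space \<Rightarrow> real"
  assumes N: "is_norm N" and "compact S" "x \<in> S" "y \<in> S"
  shows "N (x - y) \<le> norm_diameter N S"
proof -
  have "compact ((\<lambda>(x, y). N (x - y)) ` (S \<times> S))"
    unfolding case_prod_beta
    by (intro compact_continuous_image compact_Times assms
          continuous_on_compose2[OF is_norm_continuous[OF N, of UNIV]] continuous_intros) auto
  then have "bdd_above ((\<lambda>(x, y). N (x - y)) ` (S \<times> S))"
    by (intro bounded_imp_bdd_above compact_imp_bounded)
  then show ?thesis
    unfolding norm_diameter_def using cSUP_upper[of "(x, y)" "S \<times> S"] assms by fastforce
qed

section \<open>Bregman divergences and mirror steps\<close>

text \<open>
  Every linear functional is an inner product with a vector (read off on the basis), and this vector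
  is unique, so the definite description in \<^const>\<open>gradient\<close> denotes.
\<close>
lemma GDERIV_gradient:
  fixes R :: "'a::euclidean_space \<Rightarrow> real"
  assumes "R differentiable (at y)"
  shows "GDERIV R y :> gradient R y"
proof -
  obtain R' where R': "(R has_derivative R') (at y)" using assms unfolding differentiable_def by blast
  have lin: "linear R'" using R' by (rule has_derivative_linear)
  define D where "D = (\<Sum>b\<in>Basis. R' b *\<^sub>R b)"
  have "R' h = h \<bullet> D" for h
  proof -
    have "R' h = R' (\<Sum>b\<in>Basis. (h \<bullet> b) *\<^sub>R b)" by (simp add: euclidean_representation)
    also have "\<dots> = (\<Sum>b\<in>Basis. (h \<bullet> b) * R' b)"
      using lin by (simp add: linear_sum linear_scale)
    finally show ?thesis by (simp add: D_def inner_sum_right mult.commute)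
  qed
  then have "R' = (\<lambda>h. h \<bullet> D)" by (rule ext)
  then have ex: "GDERIV R y :> D"
    using R' unfolding gderiv_def by simp
  have unique: "E = E'" if "GDERIV R y :> E" "GDERIV R y :> E'" for E E'
  proof -
    have "(\<lambda>h. h \<bullet> E) = (\<lambda>h. h \<bullet> E')"
      using that unfolding gderiv_def by (rule has_derivative_unique)
    then have "(E - E') \<bullet> E = (E - E') \<bullet> E'" by (rule fun_cong)
    then have "(E - E') \<bullet> (E - E') = 0" by (simp add: inner_diff_right)
    then show ?thesis by simp
  qed
  show ?thesis unfolding gradient_def using ex by (rule theI) (rule unique[OF _ ex])
qed

lemma gradient_directional:
  fixes R :: "'a::euclidean_space \<Rightarrow> real"
  assumes "R differentiable (at y)"
  shows "((\<lambda>s. (R (y + s *\<^sub>R v) - R y) / s) \<longlongrightarrow> gradient R y \<bullet> v) (at 0)"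
proof -
  have R: "(R has_derivative (\<lambda>h. h \<bullet> gradient R y)) (at (y + 0 *\<^sub>R v))"
    using GDERIV_gradient[OF assms] by (simp add: gderiv_def)
  have "((\<lambda>s. y + s *\<^sub>R v) has_derivative (\<lambda>s. s *\<^sub>R v)) (at 0)"
    by (auto intro!: derivative_eq_intros)
  from has_derivative_compose[OF this R]
  have "((\<lambda>s. R (y + s *\<^sub>R v)) has_derivative (\<lambda>s. s * (gradient R y \<bullet> v))) (at 0)"
    by (simp add: inner_commute)
  then have "((\<lambda>s. R (y + s *\<^sub>R v)) has_real_derivative (gradient R y \<bullet> v)) (at 0)"
    by (simp add: has_field_derivative_def mult_commute_abs)
  then show ?thesis by (simp add: DERIV_def)
qed

text \<open>The law of cosines for Bregman divergences; it turns first-order optimality into a telescoping sum.\<close>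
lemma bregman_three_point:
  "(gradient R u - gradient R x) \<bullet> (z - u) = bregman R z x - bregman R z u - bregman R u x"
  unfolding bregman_def by (simp add: algebra_simps)

text \<open>
  Divide the strong convexity inequality along the segment from \<open>y\<close> to \<open>x\<close> by the step length \<open>s\<close>
  and let \<open>s\<close> tend to \<open>0\<close>: the difference quotient becomes the gradient term.
\<close>
lemma bregman_strongly_convex:
  fixes R :: "'a::euclidean_space \<Rightarrow> real"
  assumes sc: "strongly_convex_on N \<sigma> U R" and "x \<in> U" "y \<in> U" and R: "R differentiable (at y)"
  shows "\<sigma> / 2 * (N (x - y))\<^sup>2 \<le> bregman R x y"
proof -
  have "(R (y + s *\<^sub>R (x - y)) - R y) / s \<le> R x - R y - \<sigma> / 2 * (1 - s) * (N (x - y))\<^sup>2"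
    if s: "0 < s" "s < 1" for s
  proof -
    have "R (s *\<^sub>R x + (1 - s) *\<^sub>R y) \<le> s * R x + (1 - s) * R y - \<sigma> / 2 * s * (1 - s) * (N (x - y))\<^sup>2"
      using sc assms s unfolding strongly_convex_on_def by simp
    moreover have "s *\<^sub>R x + (1 - s) *\<^sub>R y = y + s *\<^sub>R (x - y)" by (simp add: algebra_simps)
    ultimately show ?thesis using s by (simp add: field_simps)
  qed
  then have ev: "\<forall>\<^sub>F s in at_right 0. (R (y + s *\<^sub>R (x - y)) - R y) / s
      \<le> R x - R y - \<sigma> / 2 * (1 - s) * (N (x - y))\<^sup>2"
    by (auto simp: eventually_at_right_field intro!: exI[of _ 1])
  have "((\<lambda>s. R x - R y - \<sigma> / 2 * (1 - s) * (N (x - y))\<^sup>2)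
      \<longlongrightarrow> R x - R y - \<sigma> / 2 * (1 - 0) * (N (x - y))\<^sup>2) (at_right 0)"
    by (intro tendsto_intros)
  moreover have "((\<lambda>s. (R (y + s *\<^sub>R (x - y)) - R y) / s) \<longlongrightarrow> gradient R y \<bullet> (x - y)) (at_right 0)"
    using gradient_directional[OF R] by (rule tendsto_within_subset) simp
  ultimately have "gradient R y \<bullet> (x - y) \<le> R x - R y - \<sigma> / 2 * (1 - 0) * (N (x - y))\<^sup>2"
    using ev by (intro tendsto_le[OF trivial_limit_at_right_real])
  then show ?thesis unfolding bregman_def by simp
qed

text \<open>A feasible direction at a minimizer cannot have negative slope.\<close>
lemma minimizer_variational_inequality:
  fixes R :: "'a::euclidean_space \<Rightarrow> real"
  assumes "convex X" "u \<in> X" "z \<in> X" and R: "R differentiable (at u)"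
    and min: "\<And>y. y \<in> X \<Longrightarrow> w \<bullet> u + R u \<le> w \<bullet> y + R y"
  shows "0 \<le> (w + gradient R u) \<bullet> (z - u)"
proof -
  have "- (w \<bullet> (z - u)) \<le> (R (u + s *\<^sub>R (z - u)) - R u) / s" if s: "0 < s" "s < 1" for s
  proof -
    have "(1 - s) *\<^sub>R u + s *\<^sub>R z \<in> X" using assms s by (intro convexD) auto
    then have "u + s *\<^sub>R (z - u) \<in> X" by (simp add: algebra_simps)
    from min[OF this] have "- (s * (w \<bullet> (z - u))) \<le> R (u + s *\<^sub>R (z - u)) - R u"
      by (simp add: inner_add_right del: inner_diff_right)
    then show ?thesis using s by (simp add: pos_le_divide_eq mult.commute)
  qed
  then have ev: "\<forall>\<^sub>F s in at_right 0. - (w \<bullet> (z - u)) \<le> (R (u + s *\<^sub>R (z - u)) - R u) / s"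
    by (auto simp: eventually_at_right_field intro!: exI[of _ 1])
  have "((\<lambda>s. (R (u + s *\<^sub>R (z - u)) - R u) / s) \<longlongrightarrow> gradient R u \<bullet> (z - u)) (at_right 0)"
    using gradient_directional[OF R] by (rule tendsto_within_subset) simp
  then have "- (w \<bullet> (z - u)) \<le> gradient R u \<bullet> (z - u)"
    using ev by (rule tendsto_lowerbound) simp
  then show ?thesis by (simp add: inner_add_left)
qed

locale mirror_map =
  fixes N :: "'a::euclidean_space \<Rightarrow> real" and X U :: "'a set" and R :: "'a \<Rightarrow> real" and \<sigma> :: real
  assumes N: "is_norm N"
    and X: "X \<noteq> {}" "convex X" "compact X"
    and U: "open U" "X \<subseteq> U"
    and \<sigma>: "\<sigma> > 0" and strongly_convex: "strongly_convex_on N \<sigma> U R"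
    and differentiable: "\<forall>y\<in>U. R differentiable (at y)"
begin

lemma continuous_on_R: "S \<subseteq> U \<Longrightarrow> continuous_on S R"
  using differentiable
  by (meson continuous_at_imp_continuous_on differentiable_imp_continuous_within subsetD)

lemma bregman_ge: "x \<in> X \<Longrightarrow> y \<in> X \<Longrightarrow> \<sigma> / 2 * (N (x - y))\<^sup>2 \<le> bregman R x y"
  using bregman_strongly_convex[OF strongly_convex] U differentiable by blast

lemma bregman_nonneg: "x \<in> X \<Longrightarrow> y \<in> X \<Longrightarrow> 0 \<le> bregman R x y"
  using bregman_ge[of x y] \<sigma> by (smt (verit) divide_nonneg_pos mult_nonneg_nonneg zero_le_power2)

text \<open>
  Only the term with the gradient at the moving point \<open>y\<close> could be large.  Continue the segment from
  \<open>z\<close> to \<open>y\<close> slightly beyond \<open>y\<close>: the end point stays in \<open>U\<close> for a step uniform in \<open>y\<close>, and by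
  convexity the slope at \<open>y\<close> is at most the difference quotient of \<open>R\<close> there, which is bounded on
  compact sets.
\<close>
lemma bregman_bounded:
  assumes z: "z \<in> X"
  shows "\<exists>C. \<forall>y\<in>X. bregman R z y \<le> C"
proof -
  obtain e where e: "e > 0" "(\<Union>x\<in>X. cball x e) \<subseteq> U"
    using compact_subset_open_imp_cball_epsilon_subset[of X U] X U by blast
  obtain L where L: "L > 0" "\<And>y. y \<in> X \<Longrightarrow> norm y \<le> L"
    using compact_imp_bounded[OF X(3)] unfolding bounded_pos by blast
  \<comment> \<open>The diameter of \<open>X\<close> is at most \<open>2 * L\<close>, so the overshoot stays within distance \<open>e\<close>.\<close>
  define s where "s = e / (2 * L)"
  have s: "s > 0" using e L unfolding s_def by simp
  define h where "h = (\<lambda>y. y + s *\<^sub>R (y - z))"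
  have hU: "h y \<in> U" if "y \<in> X" for y
  proof -
    have "norm (y - z) \<le> 2 * L" using L(2)[OF that] L(2)[OF z] norm_triangle_ineq4[of y z] by linarith
    then have "s * norm (y - z) \<le> s * (2 * L)" using s by (intro mult_left_mono) auto
    also have "\<dots> = e" unfolding s_def using L by simp
    finally have "h y \<in> cball y e" using s unfolding h_def by (simp add: dist_norm)
    then show ?thesis using e that by blast
  qed
  have "compact (h ` X)"
    unfolding h_def by (intro compact_continuous_image continuous_intros X)
  moreover have "h ` X \<subseteq> U" using hU by blast
  ultimately have "compact (R ` h ` X)"
    by (metis compact_continuous_image continuous_on_R)
  moreover have "compact (R ` X)"
    by (intro compact_continuous_image continuous_on_R X U)
  ultimately obtain B1 B2 where "\<forall>r\<in>R ` X. \<bar>r\<bar> \<le> B1" "\<forall>r\<in>R ` h ` X. \<bar>r\<bar> \<le> B2"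
    by (metis compact_imp_bounded bounded_real)
  then have B: "\<And>y. y \<in> X \<Longrightarrow> \<bar>R y\<bar> \<le> B1" "\<And>y. y \<in> X \<Longrightarrow> \<bar>R (h y)\<bar> \<le> B2"
    by auto
  have "bregman R z y \<le> 2 * B1 + (B1 + B2) / s" if y: "y \<in> X" for y
  proof -
    have "0 \<le> bregman R (h y) y"
    proof -
      have "0 \<le> \<sigma> / 2 * (N (h y - y))\<^sup>2" using \<sigma> by simp
      also have "\<dots> \<le> bregman R (h y) y"
        using bregman_strongly_convex[OF strongly_convex hU[OF y]] y U differentiable by blast
      finally show ?thesis .
    qed
    then have "s * (gradient R y \<bullet> (y - z)) \<le> R (h y) - R y"
      unfolding bregman_def h_def by simp
    also have "\<dots> \<le> B1 + B2" using B(1)[OF y] B(2)[OF y] by linarith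
    finally have "gradient R y \<bullet> (y - z) \<le> (B1 + B2) / s" using s by (simp add: field_simps)
    then show ?thesis
      using B(1)[OF y] B(1)[OF z] unfolding bregman_def by (simp add: inner_diff_right)
  qed
  then show ?thesis by blast
qed

text \<open>
  A minimizer exists for every dual vector \<open>w\<close>, which makes \<open>prox_map\<close> total and Lipschitz on the
  whole space, hence measurable as a function of \<open>w\<close>.
\<close>
definition prox_map :: "'a \<Rightarrow> 'a" where
  "prox_map w = (SOME u. u \<in> X \<and> (\<forall>y\<in>X. w \<bullet> u + R u \<le> w \<bullet> y + R y))"

lemma prox_map_minimizes: "prox_map w \<in> X \<and> (\<forall>y\<in>X. w \<bullet> prox_map w + R (prox_map w) \<le> w \<bullet> y + R y)"
proof -
  have "\<exists>u\<in>X. \<forall>y\<in>X. w \<bullet> u + R u \<le> w \<bullet> y + R y"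
    using X U by (intro continuous_attains_inf continuous_intros continuous_on_R) auto
  then have "\<exists>u. u \<in> X \<and> (\<forall>y\<in>X. w \<bullet> u + R u \<le> w \<bullet> y + R y)" by blast
  then show ?thesis unfolding prox_map_def by (rule someI_ex)
qed

text \<open>
  Add the variational inequalities of the two minimizers, each tested at the other one; the
  symmetrized divergence that appears is at least \<open>\<sigma>\<close> times the squared distance.
\<close>
lemma minimizer_stable:
  assumes u: "u \<in> X" "\<forall>y\<in>X. w \<bullet> u + R u \<le> w \<bullet> y + R y"
    and v: "v \<in> X" "\<forall>y\<in>X. w' \<bullet> v + R v \<le> w' \<bullet> y + R y"
  shows "\<sigma> * N (u - v) \<le> dual_norm N (w - w')"
proof -
  have "0 \<le> (w + gradient R u) \<bullet> (v - u)" "0 \<le> (w' + gradient R v) \<bullet> (u - v)"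
    using minimizer_variational_inequality[OF X(2)] u v U differentiable by blast+
  moreover have "(w + gradient R u) \<bullet> (v - u) + (w' + gradient R v) \<bullet> (u - v)
      = (w - w') \<bullet> (v - u) - bregman R u v - bregman R v u"
    unfolding bregman_def by (simp add: algebra_simps)
  ultimately have "bregman R u v + bregman R v u \<le> (w - w') \<bullet> (v - u)" by linarith
  moreover have "N (v - u) = N (u - v)" using is_norm_minus[OF N, of "u - v"] by simp
  ultimately have "\<sigma> * (N (u - v))\<^sup>2 \<le> dual_norm N (w - w') * N (u - v)"
    using bregman_ge[OF u(1) v(1)] bregman_ge[OF v(1) u(1)]
      inner_le_dual_norm[OF N, of "w - w'" "v - u"] by simp
  then have "N (u - v) * (\<sigma> * N (u - v)) \<le> N (u - v) * dual_norm N (w - w')"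
    by (simp add: power2_eq_square mult_ac)
  then show ?thesis
    using is_norm_nonneg[OF N, of "u - v"] dual_norm_nonneg[OF N, of "w - w'"]
    by (cases "N (u - v) = 0") auto
qed

lemma prox_map_measurable [measurable]: "prox_map \<in> borel_measurable borel"
proof -
  obtain C1 where C1: "C1 > 0" "\<And>x. norm x \<le> C1 * N x" using norm_le_is_norm[OF N] by blast
  obtain C2 where C2: "C2 > 0" "\<And>x. dual_norm N x \<le> C2 * norm x"
    using is_norm_le_norm[OF dual_norm_is_norm[OF N]] by blast
  have "norm (prox_map w - prox_map w') \<le> (C1 * C2 / \<sigma>) * norm (w - w')" for w w'
  proof -
    have "\<sigma> * norm (prox_map w - prox_map w') \<le> C1 * (\<sigma> * N (prox_map w - prox_map w'))"
      using C1(2)[of "prox_map w - prox_map w'"] \<sigma> by (simp add: mult.left_commute)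
    also have "\<dots> \<le> C1 * dual_norm N (w - w')"
      using C1(1) prox_map_minimizes by (intro mult_left_mono minimizer_stable) auto
    also have "\<dots> \<le> C1 * (C2 * norm (w - w'))" using C1(1) C2(2) by (intro mult_left_mono) auto
    finally show ?thesis using \<sigma> by (simp add: field_simps)
  qed
  then have "(C1 * C2 / \<sigma>)-lipschitz_on UNIV prox_map"
    using C1(1) C2(1) \<sigma> by (intro lipschitz_onI) (auto simp: dist_norm)
  then show ?thesis by (intro borel_measurable_continuous_onI lipschitz_on_continuous_on)
qed

context
  fixes x h u :: 'a and a :: real
  assumes x: "x \<in> X" and a: "a > 0"
    and u: "is_arg_min (\<lambda>y. h \<bullet> (y - x) + 1 / a * bregman R y x) (\<lambda>y. y \<in> X) u"
begin

lemma mirror_step_mem: "u \<in> X"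
  using u unfolding is_arg_min_def by blast

lemma mirror_step_minimizes:
  assumes "y \<in> X"
  shows "(a *\<^sub>R h - gradient R x) \<bullet> u + R u \<le> (a *\<^sub>R h - gradient R x) \<bullet> y + R y"
proof -
  have "h \<bullet> (u - x) + 1 / a * bregman R u x \<le> h \<bullet> (y - x) + 1 / a * bregman R y x"
    using u assms unfolding is_arg_min_def by force
  then have "a * (h \<bullet> (u - x) + 1 / a * bregman R u x) \<le> a * (h \<bullet> (y - x) + 1 / a * bregman R y x)"
    using a by (intro mult_left_mono) auto
  then show ?thesis using a unfolding bregman_def by (simp add: algebra_simps)
qed

text \<open>
  A mirror step depends on the state and the noisy gradient only through one dual vector.  With
  \<open>prox_map_measurable\<close> this is why iterates, specified merely as minimizers, are measurable.
\<close>
lemma mirror_step_eq_prox_map: "u = prox_map (a *\<^sub>R h - gradient R x)"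
proof -
  have "\<sigma> * N (u - prox_map (a *\<^sub>R h - gradient R x)) \<le> 0"
    using minimizer_stable[OF mirror_step_mem ballI[OF mirror_step_minimizes]]
      prox_map_minimizes[of "a *\<^sub>R h - gradient R x"] is_norm_eq_0[OF dual_norm_is_norm[OF N], of 0]
    by fastforce
  then have "N (u - prox_map (a *\<^sub>R h - gradient R x)) = 0"
    using \<sigma> is_norm_nonneg[OF N] by (metis mult_le_0_iff not_le order_antisym)
  then show ?thesis using is_norm_eq_0[OF N] by simp
qed

text \<open>
  The variational inequality at \<open>u\<close> tested at \<open>z\<close> bounds \<open>a \<langle>h, u - z\<rangle>\<close> by a difference of
  divergences minus \<open>D\<^sub>R(u, x)\<close>.  The remaining \<open>a \<langle>h, x - u\<rangle>\<close> is at most \<open>a \<parallel>h\<parallel>\<^sub>* \<parallel>x - u\<parallel>\<close>, and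
  Young's inequality absorbs it into \<open>D\<^sub>R(u, x) \<ge> \<sigma>/2 \<parallel>x - u\<parallel>\<^sup>2\<close>.
\<close>
lemma mirror_step_descent:
  assumes z: "z \<in> X"
  shows "a * (h \<bullet> (x - z)) \<le> bregman R z x - bregman R z u + a\<^sup>2 / (2 * \<sigma>) * (dual_norm N h)\<^sup>2"
proof -
  define n where "n = N (u - x)"
  define d where "d = dual_norm N h"
  have "0 \<le> ((a *\<^sub>R h - gradient R x) + gradient R u) \<bullet> (z - u)"
    using mirror_step_mem z U differentiable
    by (intro minimizer_variational_inequality[OF X(2)] mirror_step_minimizes) auto
  then have "a * (h \<bullet> (u - z)) \<le> (gradient R u - gradient R x) \<bullet> (z - u)"
    by (simp add: algebra_simps)
  also have "\<dots> = bregman R z x - bregman R z u - bregman R u x" by (rule bregman_three_point)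
  also have "\<dots> \<le> bregman R z x - bregman R z u - \<sigma> / 2 * n\<^sup>2"
    using bregman_ge[OF mirror_step_mem x] unfolding n_def by simp
  finally have 1: "a * (h \<bullet> (u - z)) \<le> bregman R z x - bregman R z u - \<sigma> / 2 * n\<^sup>2" .
  have "h \<bullet> (x - u) \<le> d * n"
    using inner_le_dual_norm[OF N, of h "x - u"] is_norm_minus[OF N, of "u - x"]
    unfolding d_def n_def by simp
  then have 2: "a * (h \<bullet> (x - u)) \<le> a * (d * n)" using a by simp
  \<comment> \<open>Young's inequality, with the weight that cancels the quadratic term.\<close>
  have "0 \<le> (a * d - \<sigma> * n)\<^sup>2 / (2 * \<sigma>)" using \<sigma> by simp
  also have "\<dots> = a\<^sup>2 / (2 * \<sigma>) * d\<^sup>2 - a * (d * n) + \<sigma> / 2 * n\<^sup>2"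
    using \<sigma> by (simp add: field_simps power2_eq_square)
  finally have 3: "a * (d * n) \<le> a\<^sup>2 / (2 * \<sigma>) * d\<^sup>2 + \<sigma> / 2 * n\<^sup>2" by simp
  have "a * (h \<bullet> (x - z)) = a * (h \<bullet> (x - u)) + a * (h \<bullet> (u - z))" by (simp add: algebra_simps)
  then show ?thesis using 1 2 3 unfolding d_def by linarith
qed

end

context
  fixes M :: "'w measure" and Y :: "'w \<Rightarrow> 'a"
  assumes Y [measurable]: "Y \<in> borel_measurable M" and YX: "\<And>\<omega>. \<omega> \<in> space M \<Longrightarrow> Y \<omega> \<in> X"
begin

text \<open>
  Partial derivatives are limits of difference quotients, and a point of the open set \<open>U\<close> stays in
  \<open>U\<close> after a small displacement, so \<open>R\<close> may be replaced by its extension by zero outside \<open>U\<close>.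
\<close>
lemma gradient_measurable: "(\<lambda>\<omega>. gradient R (Y \<omega>)) \<in> borel_measurable M"
proof (subst borel_measurable_euclidean_space, intro ballI)
  fix i :: 'a assume "i \<in> Basis"
  define R0 where "R0 = (\<lambda>y. indicator U y *\<^sub>R R y)"
  have [measurable]: "R0 \<in> borel_measurable borel"
    unfolding R0_def using U continuous_on_R[of U]
    by (intro borel_measurable_continuous_on_indicator) auto
  define s where "s = (\<lambda>n. inverse (real (Suc n)))"
  show "(\<lambda>\<omega>. gradient R (Y \<omega>) \<bullet> i) \<in> borel_measurable M"
  proof (rule borel_measurable_LIMSEQ_real)
    show "(\<lambda>\<omega>. (R0 (Y \<omega> + s n *\<^sub>R i) - R0 (Y \<omega>)) / s n) \<in> borel_measurable M" for n
      by measurable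
    fix \<omega> assume "\<omega> \<in> space M"
    then have Y\<omega>: "Y \<omega> \<in> U" using YX U by blast
    have s0: "filterlim s (at 0) sequentially"
      unfolding s_def filterlim_at using LIMSEQ_inverse_real_of_nat by auto
    have lim: "(\<lambda>n. (R (Y \<omega> + s n *\<^sub>R i) - R (Y \<omega>)) / s n) \<longlonglongrightarrow> gradient R (Y \<omega>) \<bullet> i"
      using filterlim_compose[OF gradient_directional s0] differentiable Y\<omega> by blast
    have "(\<lambda>n. Y \<omega> + s n *\<^sub>R i) \<longlonglongrightarrow> Y \<omega> + 0 *\<^sub>R i"
      unfolding s_def by (intro tendsto_intros LIMSEQ_inverse_real_of_nat)
    then have "\<forall>\<^sub>F n in sequentially. Y \<omega> + s n *\<^sub>R i \<in> U"
      using U Y\<omega> by (intro topological_tendstoD) auto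
    then have "\<forall>\<^sub>F n in sequentially. (R (Y \<omega> + s n *\<^sub>R i) - R (Y \<omega>)) / s n
        = (R0 (Y \<omega> + s n *\<^sub>R i) - R0 (Y \<omega>)) / s n"
      by eventually_elim (use Y\<omega> in \<open>simp add: R0_def\<close>)
    then show "(\<lambda>n. (R0 (Y \<omega> + s n *\<^sub>R i) - R0 (Y \<omega>)) / s n) \<longlonglongrightarrow> gradient R (Y \<omega>) \<bullet> i"
      by (rule Lim_transform_eventually[OF lim])
  qed
qed

lemma bregman_measurable: "(\<lambda>\<omega>. bregman R z (Y \<omega>)) \<in> borel_measurable M"
proof -
  have "(\<lambda>y. indicator U y *\<^sub>R R y) \<in> borel_measurable borel"
    using U continuous_on_R[of U] by (intro borel_measurable_continuous_on_indicator) auto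
  from measurable_compose[OF Y this]
  have "(\<lambda>\<omega>. R (Y \<omega>)) \<in> borel_measurable M"
    by (rule measurable_cong[THEN iffD1, rotated]) (use YX U in \<open>auto simp: indicator_def\<close>)
  note [measurable] = this gradient_measurable
  show ?thesis unfolding bregman_def by measurable
qed

end

end

section \<open>Conditional expectations and the history of a process\<close>

lemma integrable_mult_of_squares:
  fixes u v :: "'a \<Rightarrow> real"
  assumes [measurable]: "u \<in> borel_measurable M" "v \<in> borel_measurable M"
    and "integrable M (\<lambda>\<omega>. (u \<omega>)\<^sup>2)" "integrable M (\<lambda>\<omega>. (v \<omega>)\<^sup>2)"
  shows "integrable M (\<lambda>\<omega>. u \<omega> * v \<omega>)"
proof (rule Bochner_Integration.integrable_bound)
  show "integrable M (\<lambda>\<omega>. (u \<omega>)\<^sup>2 + (v \<omega>)\<^sup>2)" using assms by simp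
  have "\<bar>a * b\<bar> \<le> a\<^sup>2 + b\<^sup>2" for a b :: real
  proof -
    have "0 \<le> (\<bar>a\<bar> - \<bar>b\<bar>)\<^sup>2" "0 \<le> a\<^sup>2" "0 \<le> b\<^sup>2" by auto
    moreover have "(\<bar>a\<bar> - \<bar>b\<bar>)\<^sup>2 = a\<^sup>2 + b\<^sup>2 - 2 * \<bar>a * b\<bar>"
      by (simp add: power2_diff abs_mult)
    ultimately show ?thesis by linarith
  qed
  then show "AE \<omega> in M. norm (u \<omega> * v \<omega>) \<le> norm ((u \<omega>)\<^sup>2 + (v \<omega>)\<^sup>2)" by simp
qed measurable

lemma subalgebra_trans: "subalgebra M G \<Longrightarrow> subalgebra G F \<Longrightarrow> subalgebra M F"
  unfolding subalgebra_def by auto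

lemma (in prob_space) sigma_finite_subalgebra_if_subalgebra:
  "subalgebra M F \<Longrightarrow> sigma_finite_subalgebra M F"
  by (intro finite_measure_subalgebra_is_sigma_finite) (unfold_locales)

lemma history_generators: "{x s -` A \<inter> space M | s A. s \<in> {1..t} \<and> A \<in> sets borel} \<subseteq> Pow (space M)"
  by auto

lemma space_history [simp]: "space (history M x t) = space M"
  unfolding history_def by (rule space_measure_of[OF history_generators])

lemma sets_history:
  "sets (history M x t) = sigma_sets (space M) {x s -` A \<inter> space M | s A. s \<in> {1..t} \<and> A \<in> sets borel}"
  unfolding history_def by (rule sets_measure_of[OF history_generators])

lemma history_measurable:
  assumes "s \<in> {1..t}"
  shows "x s \<in> borel_measurable (history M x t)"
  using assms by (intro measurableI) (auto simp: sets_history)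

lemma history_subalgebra:
  assumes "\<And>s. s \<in> {1..t} \<Longrightarrow> x s \<in> borel_measurable M"
  shows "subalgebra M (history M x t)"
  unfolding subalgebra_def sets_history
  using assms by (auto intro!: sets.sigma_sets_subset measurable_sets)

lemma history_mono:
  assumes "s \<le> t"
  shows "subalgebra (history M x t) (history M x s)"
  unfolding subalgebra_def sets_history
  using assms by (force intro!: sigma_sets_mono')

text \<open>
  The tower property, carried out in \<^typ>\<open>ennreal\<close> because integrability is part of the conclusion.
\<close>
lemma (in prob_space) second_moment_le_of_cond:
  assumes F: "subalgebra M F" and N [measurable]: "N \<in> borel_measurable borel"
    and Y [measurable]: "Y \<in> borel_measurable M"
    and c: "0 \<le> c" and le: "cond_second_moment_le M F N Y c"
  shows "integrable M (\<lambda>\<omega>. (N (Y \<omega>))\<^sup>2)" "expectation (\<lambda>\<omega>. (N (Y \<omega>))\<^sup>2) \<le> c"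
proof -
  interpret sigma_finite_subalgebra M F by (rule sigma_finite_subalgebra_if_subalgebra[OF F])
  have "(\<integral>\<^sup>+\<omega>. ennreal ((N (Y \<omega>))\<^sup>2) \<partial>M) = (\<integral>\<^sup>+\<omega>. nn_cond_exp M F (\<lambda>\<omega>. ennreal ((N (Y \<omega>))\<^sup>2)) \<omega> \<partial>M)"
    using nn_cond_exp_intg[of "\<lambda>_. 1" "\<lambda>\<omega>. ennreal ((N (Y \<omega>))\<^sup>2)"] by simp
  also have "\<dots> \<le> (\<integral>\<^sup>+\<omega>. ennreal c \<partial>M)"
    using le unfolding cond_second_moment_le_def by (rule nn_integral_mono_AE)
  also have "\<dots> = ennreal c" by (simp add: emeasure_space_1)
  finally have nn: "(\<integral>\<^sup>+\<omega>. ennreal ((N (Y \<omega>))\<^sup>2) \<partial>M) \<le> ennreal c" .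
  then show int: "integrable M (\<lambda>\<omega>. (N (Y \<omega>))\<^sup>2)"
    by (intro integrableI_bounded) (auto simp: le_less_trans)
  show "expectation (\<lambda>\<omega>. (N (Y \<omega>))\<^sup>2) \<le> c"
    using nn c by (simp add: nn_integral_eq_integral[OF int])
qed

text \<open>Taking out what is known, coordinate by coordinate.\<close>
lemma (in prob_space) real_cond_exp_inner:
  fixes Y h :: "'a \<Rightarrow> real ^ 'n"
  assumes F: "subalgebra M F" and [measurable]: "h \<in> borel_measurable F" "Y \<in> borel_measurable M"
    and int: "\<And>i. integrable M (\<lambda>\<omega>. h \<omega> $ i * Y \<omega> $ i)"
  shows "AE \<omega> in M. real_cond_exp M F (\<lambda>\<omega>. Y \<omega> \<bullet> h \<omega>) \<omega> = vec_cond_exp M F Y \<omega> \<bullet> h \<omega>"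
proof -
  interpret sigma_finite_subalgebra M F by (rule sigma_finite_subalgebra_if_subalgebra[OF F])
  have [measurable]: "(\<lambda>v :: real ^ 'n. v $ i) \<in> borel_measurable borel" for i
    by (intro borel_measurable_continuous_onI continuous_intros)
  have eq: "(\<lambda>\<omega>. Y \<omega> \<bullet> h \<omega>) = (\<lambda>\<omega>. \<Sum>i\<in>UNIV. h \<omega> $ i * Y \<omega> $ i)"
    by (simp add: inner_vec_def mult.commute)
  have "AE \<omega> in M. \<forall>i\<in>UNIV. real_cond_exp M F (\<lambda>\<omega>. h \<omega> $ i * Y \<omega> $ i) \<omega>
      = h \<omega> $ i * real_cond_exp M F (\<lambda>\<omega>. Y \<omega> $ i) \<omega>"
    by (intro AE_finite_allI real_cond_exp_mult int) (simp, measurable)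
  moreover have "AE \<omega> in M. real_cond_exp M F (\<lambda>\<omega>. Y \<omega> \<bullet> h \<omega>) \<omega>
      = (\<Sum>i\<in>UNIV. real_cond_exp M F (\<lambda>\<omega>. h \<omega> $ i * Y \<omega> $ i) \<omega>)"
    unfolding eq by (intro real_cond_exp_sum int)
  ultimately show ?thesis
    by eventually_elim (simp add: vec_cond_exp_def inner_vec_def mult.commute)
qed

text \<open>
  Projecting a variable that is centered given \<open>F\<close> onto a finer \<open>\<sigma>\<close>-algebra \<open>G\<close> keeps it centered
  (tower property) and does not increase its second moment (Jensen).  This is how noise that the
  history does not record is replaced by noise that it does.
\<close>
lemma (in prob_space) cond_exp_centered:
  assumes G: "subalgebra M G" and F: "subalgebra G F"
    and Z: "Z \<in> borel_measurable M" "integrable M (\<lambda>\<omega>. (Z \<omega>)\<^sup>2)" and mean: "AE \<omega> in M. real_cond_exp M F Z \<omega> = 0"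
  shows "integrable M (\<lambda>\<omega>. (real_cond_exp M G Z \<omega>)\<^sup>2)"
    and "expectation (\<lambda>\<omega>. (real_cond_exp M G Z \<omega>)\<^sup>2) \<le> expectation (\<lambda>\<omega>. (Z \<omega>)\<^sup>2)"
    and "AE \<omega> in M. real_cond_exp M F (real_cond_exp M G Z) \<omega> = 0"
proof -
  interpret G: sigma_finite_subalgebra M G by (rule sigma_finite_subalgebra_if_subalgebra[OF G])
  interpret F: sigma_finite_subalgebra M F
    by (rule sigma_finite_subalgebra_if_subalgebra[OF subalgebra_trans[OF G F]])
  have Zint: "integrable M Z" using Z by (rule square_integrable_imp_integrable)
  show int: "integrable M (\<lambda>\<omega>. (real_cond_exp M G Z \<omega>)\<^sup>2)"
    by (rule G.integrable_convex_cond_exp[OF Zint, of UNIV]) (use Z convex_power2 in auto)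
  have "AE \<omega> in M. (real_cond_exp M G Z \<omega>)\<^sup>2 \<le> real_cond_exp M G (\<lambda>\<omega>. (Z \<omega>)\<^sup>2) \<omega>"
    by (rule G.real_cond_exp_jensens_inequality(2)[OF Zint, of UNIV]) (use Z convex_power2 in auto)
  then have "expectation (\<lambda>\<omega>. (real_cond_exp M G Z \<omega>)\<^sup>2) \<le> expectation (real_cond_exp M G (\<lambda>\<omega>. (Z \<omega>)\<^sup>2))"
    by (intro integral_mono_AE int G.real_cond_exp_int Z)
  then show "expectation (\<lambda>\<omega>. (real_cond_exp M G Z \<omega>)\<^sup>2) \<le> expectation (\<lambda>\<omega>. (Z \<omega>)\<^sup>2)"
    using G.real_cond_exp_int(2)[OF Z(2)] by simp
  show "AE \<omega> in M. real_cond_exp M F (real_cond_exp M G Z) \<omega> = 0"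
    using F.real_cond_exp_nested_subalg[OF G F Zint] mean by eventually_elim simp
qed

text \<open>
  Martingale differences are orthogonal: the partial sum up to \<open>t\<close> is \<open>F (t + 1)\<close>-measurable, so
  in the cross term the next difference may be replaced by its conditional mean \<open>0\<close>.
\<close>
lemma (in prob_space) martingale_difference_second_moment:
  fixes \<eta> :: "nat \<Rightarrow> 'a \<Rightarrow> real" and c :: "nat \<Rightarrow> real"
  assumes F: "\<And>t. 1 \<le> t \<Longrightarrow> subalgebra M (F t)"
    and mono: "\<And>s t. 1 \<le> s \<Longrightarrow> s \<le> t \<Longrightarrow> subalgebra (F t) (F s)"
    and meas: "\<And>t. 1 \<le> t \<Longrightarrow> \<eta> t \<in> borel_measurable (F (Suc t))"
    and sq: "\<And>t. 1 \<le> t \<Longrightarrow> integrable M (\<lambda>\<omega>. (\<eta> t \<omega>)\<^sup>2)"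
    and mean: "\<And>t. 1 \<le> t \<Longrightarrow> AE \<omega> in M. real_cond_exp M (F t) (\<eta> t) \<omega> = 0"
  shows "integrable M (\<lambda>\<omega>. (\<Sum>k=1..t. c k * \<eta> k \<omega>)\<^sup>2)
    \<and> expectation (\<lambda>\<omega>. (\<Sum>k=1..t. c k * \<eta> k \<omega>)\<^sup>2) = (\<Sum>k=1..t. (c k)\<^sup>2 * expectation (\<lambda>\<omega>. (\<eta> k \<omega>)\<^sup>2))"
proof (induction t)
  case (Suc t)
  define S where "S = (\<lambda>\<omega>. \<Sum>k=1..t. c k * \<eta> k \<omega>)"
  define \<eta>' where "\<eta>' = \<eta> (Suc t)"
  interpret sigma_finite_subalgebra M "F (Suc t)"
    by (rule sigma_finite_subalgebra_if_subalgebra[OF F]) simp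
  have SF: "S \<in> borel_measurable (F (Suc t))"
    unfolding S_def
  proof (intro borel_measurable_sum borel_measurable_times borel_measurable_const)
    fix k assume k: "k \<in> {1..t}"
    show "\<eta> k \<in> borel_measurable (F (Suc t))"
      by (rule measurable_from_subalg[OF mono meas]) (use k in auto)
  qed
  have [measurable]: "S \<in> borel_measurable M" "\<eta>' \<in> borel_measurable M"
    using measurable_from_subalg[OF F SF] measurable_from_subalg[OF F meas, of "Suc t"]
    unfolding \<eta>'_def by auto
  have Ssq: "integrable M (\<lambda>\<omega>. (S \<omega>)\<^sup>2)" and \<eta>sq: "integrable M (\<lambda>\<omega>. (\<eta>' \<omega>)\<^sup>2)"
    using Suc sq unfolding S_def \<eta>'_def by auto
  have cross: "integrable M (\<lambda>\<omega>. S \<omega> * \<eta>' \<omega>)"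
    by (rule integrable_mult_of_squares) (use Ssq \<eta>sq in auto)
  have "expectation (\<lambda>\<omega>. S \<omega> * \<eta>' \<omega>) = expectation (\<lambda>\<omega>. S \<omega> * real_cond_exp M (F (Suc t)) \<eta>' \<omega>)"
    using real_cond_exp_intg(2)[OF cross SF] by simp
  also have "\<dots> = expectation (\<lambda>\<omega>. 0)"
    using mean[of "Suc t"] unfolding \<eta>'_def[symmetric] by (intro integral_cong_AE) auto
  finally have zero: "expectation (\<lambda>\<omega>. S \<omega> * \<eta>' \<omega>) = 0" by simp
  have eq: "(\<lambda>\<omega>. (\<Sum>k=1..Suc t. c k * \<eta> k \<omega>)\<^sup>2)
      = (\<lambda>\<omega>. (S \<omega>)\<^sup>2 + 2 * c (Suc t) * (S \<omega> * \<eta>' \<omega>) + (c (Suc t))\<^sup>2 * (\<eta>' \<omega>)\<^sup>2)"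
    unfolding S_def \<eta>'_def by (simp add: power2_sum power_mult_distrib algebra_simps)
  show ?case
    unfolding eq using Ssq \<eta>sq cross zero Suc.IH by (simp add: S_def \<eta>'_def)
qed simp

section \<open>Stochastic mirror descent\<close>

locale stochastic_mirror_descent = mirror_map N X U R \<sigma> + prob_space M
  for N :: "real ^ 'n \<Rightarrow> real" and X U R \<sigma> and M :: "'w measure" +
  fixes f :: "real ^ 'n \<Rightarrow> real"
    and x gt g b :: "nat \<Rightarrow> 'w \<Rightarrow> real ^ 'n"
    and \<alpha> B :: "nat \<Rightarrow> real"
    and \<nu> G \<kappa> :: real
  assumes f_convex: "convex_on UNIV f"
    and subgradient_bound: "\<And>y h. y \<in> X \<Longrightarrow> h \<in> subdifferential f y \<Longrightarrow> dual_norm N h \<le> G"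
    and \<kappa>_pos: "\<kappa> > 0"
    and \<kappa>: "\<And>u v w. (dual_norm N (u + v + w))\<^sup>2
           \<le> \<kappa> * ((dual_norm N u)\<^sup>2 + (dual_norm N v)\<^sup>2 + (dual_norm N w)\<^sup>2)"
    and x1: "x 1 \<in> borel_measurable M" "\<And>\<omega>. \<omega> \<in> space M \<Longrightarrow> x 1 \<omega> \<in> X"
    and \<alpha>_pos: "\<And>t. 1 \<le> t \<Longrightarrow> \<alpha> t > 0"
    and gt_measurable: "\<And>t. 1 \<le> t \<Longrightarrow> gt t \<in> borel_measurable M"
    and iterates: "\<And>t \<omega>. 1 \<le> t \<Longrightarrow> \<omega> \<in> space M \<Longrightarrow>
           is_arg_min (\<lambda>y. gt t \<omega> \<bullet> (y - x t \<omega>) + 1 / \<alpha> t * bregman R y (x t \<omega>))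
             (\<lambda>y. y \<in> X) (x (Suc t) \<omega>)"
    and mean: "\<And>t. 1 \<le> t \<Longrightarrow> AE \<omega> in M. vec_cond_exp M (history M x t) (gt t) \<omega> = g t \<omega> + b t \<omega>"
    and subgradient: "\<And>t. 1 \<le> t \<Longrightarrow> AE \<omega> in M. g t \<omega> \<in> subdifferential f (x t \<omega>)"
    and moment: "\<And>t. 1 \<le> t \<Longrightarrow> cond_second_moment_le M (history M x t) (dual_norm N) (gt t) (\<nu>\<^sup>2)"
    and B_nonneg: "\<And>t. 1 \<le> t \<Longrightarrow> B t \<ge> 0"
    and bias: "\<And>t. 1 \<le> t \<Longrightarrow> AE \<omega> in M. dual_norm N (b t \<omega>) \<le> B t"
begin

abbreviation "F \<equiv> history M x"
abbreviation "D \<equiv> norm_diameter N X"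

lemma x_mem: "1 \<le> t \<Longrightarrow> \<omega> \<in> space M \<Longrightarrow> x t \<omega> \<in> X"
proof (induction t rule: nat_induct_at_least)
  case (Suc t)
  then show ?case using iterates[of t \<omega>] unfolding is_arg_min_def by blast
qed (use x1 in simp)

lemma x_measurable: "1 \<le> t \<Longrightarrow> x t \<in> borel_measurable M"
proof (induction t rule: nat_induct_at_least)
  case (Suc t)
  note [measurable] = Suc.IH gt_measurable[OF Suc.hyps]
  have [measurable]: "(\<lambda>\<omega>. gradient R (x t \<omega>)) \<in> borel_measurable M"
    by (rule gradient_measurable) (use x_mem Suc in auto)
  have "x (Suc t) \<omega> = prox_map (\<alpha> t *\<^sub>R gt t \<omega> - gradient R (x t \<omega>))" if "\<omega> \<in> space M" for \<omega>
    using mirror_step_eq_prox_map iterates x_mem \<alpha>_pos Suc.hyps that by blast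
  then show ?case
    by (subst measurable_cong[where g = "\<lambda>\<omega>. prox_map (\<alpha> t *\<^sub>R gt t \<omega> - gradient R (x t \<omega>))"]) auto
qed (use x1 in simp)

lemma F_subalgebra: "subalgebra M (F t)"
  by (rule history_subalgebra) (simp add: x_measurable)

lemma x_F_measurable: "1 \<le> s \<Longrightarrow> s \<le> t \<Longrightarrow> x s \<in> borel_measurable (F t)"
  by (rule history_measurable) simp

lemma F_sigma_finite: "sigma_finite_subalgebra M (F t)"
  by (rule sigma_finite_subalgebra_if_subalgebra[OF F_subalgebra])

lemma gt_second_moment:
  assumes "1 \<le> t"
  shows "integrable M (\<lambda>\<omega>. (dual_norm N (gt t \<omega>))\<^sup>2)" "expectation (\<lambda>\<omega>. (dual_norm N (gt t \<omega>))\<^sup>2) \<le> \<nu>\<^sup>2"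
  using second_moment_le_of_cond[OF F_subalgebra dual_norm_measurable[OF N] gt_measurable[OF assms] _ moment[OF assms]]
  by auto

context
  fixes xs assumes xs: "xs \<in> X"
begin

lemma N_x_le: "1 \<le> t \<Longrightarrow> \<omega> \<in> space M \<Longrightarrow> N (x t \<omega> - xs) \<le> D"
  by (intro norm_diameter_upper[OF N X(3)] x_mem xs)

lemma D_nonneg: "0 \<le> D"
  using norm_diameter_upper[OF N X(3) xs xs] is_norm_nonneg[OF N, of "xs - xs"] by linarith

lemma inner_sq_le:
  assumes "1 \<le> t" "\<omega> \<in> space M"
  shows "(v \<bullet> (x t \<omega> - xs))\<^sup>2 \<le> D\<^sup>2 * (dual_norm N v)\<^sup>2"
proof -
  have "\<bar>v \<bullet> (x t \<omega> - xs)\<bar> \<le> dual_norm N v * N (x t \<omega> - xs)" by (rule abs_inner_le_dual_norm[OF N])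
  also have "\<dots> \<le> dual_norm N v * D"
    by (intro mult_left_mono N_x_le dual_norm_nonneg[OF N] assms)
  finally have "\<bar>v \<bullet> (x t \<omega> - xs)\<bar>\<^sup>2 \<le> (dual_norm N v * D)\<^sup>2" by (rule power_mono) simp
  then show ?thesis by (simp add: power_mult_distrib mult.commute)
qed

text \<open>
  \<open>gain\<close> is what one step earns in the pathwise inequality.  \<open>predicted_gain\<close> is its conditional mean
  before the step.  \<open>visible_noise\<close> and \<open>visible_moment\<close> are the noise and the squared dual norm of
  the noisy gradient as far as the iterates up to \<open>t + 1\<close> reveal them.
\<close>
definition gain :: "nat \<Rightarrow> 'w \<Rightarrow> real" where
  "gain t \<omega> = gt t \<omega> \<bullet> (x t \<omega> - xs)"

definition predicted_gain :: "nat \<Rightarrow> 'w \<Rightarrow> real" where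
  "predicted_gain t = real_cond_exp M (F t) (gain t)"

definition visible_noise :: "nat \<Rightarrow> 'w \<Rightarrow> real" where
  "visible_noise t = real_cond_exp M (F (Suc t)) (\<lambda>\<omega>. gain t \<omega> - predicted_gain t \<omega>)"

definition visible_moment :: "nat \<Rightarrow> 'w \<Rightarrow> real" where
  "visible_moment t = real_cond_exp M (F (Suc t)) (\<lambda>\<omega>. (dual_norm N (gt t \<omega>))\<^sup>2)"

lemma gain_measurable: "1 \<le> t \<Longrightarrow> gain t \<in> borel_measurable M"
  using gt_measurable x_measurable unfolding gain_def by measurable

lemma gain_sq_integrable:
  assumes t: "1 \<le> t"
  shows "integrable M (\<lambda>\<omega>. (gain t \<omega>)\<^sup>2)"
proof (rule Bochner_Integration.integrable_bound)
  show "integrable M (\<lambda>\<omega>. D\<^sup>2 * (dual_norm N (gt t \<omega>))\<^sup>2)" using gt_second_moment[OF t] by simp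
  show "AE \<omega> in M. norm ((gain t \<omega>)\<^sup>2) \<le> norm (D\<^sup>2 * (dual_norm N (gt t \<omega>))\<^sup>2)"
    using inner_sq_le[OF t] by (intro AE_I2) (simp add: gain_def)
qed (use gain_measurable[OF t] in measurable)

lemma gain_integrable: "1 \<le> t \<Longrightarrow> integrable M (gain t)"
  using gain_measurable gain_sq_integrable by (rule square_integrable_imp_integrable)

lemma predicted_gain_F_measurable: "predicted_gain t \<in> borel_measurable (F t)"
  unfolding predicted_gain_def by simp

lemma predicted_gain_measurable [measurable]: "predicted_gain t \<in> borel_measurable M"
  unfolding predicted_gain_def by simp

lemma predicted_gain_integrable: "1 \<le> t \<Longrightarrow> integrable M (predicted_gain t)"
  unfolding predicted_gain_def
  by (intro sigma_finite_subalgebra.real_cond_exp_int[OF F_sigma_finite] gain_integrable)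

text \<open>
  The point \<open>x(t) - x\<^sub>*\<close> is known at time \<open>t\<close>.  The work is to justify pulling it out: the
  coordinates of \<open>gt(t)\<close> are square integrable and those of \<open>x(t) - x\<^sub>*\<close> are bounded.
\<close>
lemma predicted_gain_eq:
  assumes t: "1 \<le> t"
  shows "AE \<omega> in M. predicted_gain t \<omega> = (g t \<omega> + b t \<omega>) \<bullet> (x t \<omega> - xs)"
proof -
  note [measurable] = gt_measurable[OF t] x_measurable[OF t] x_F_measurable[OF t order_refl]
  have [measurable]: "(\<lambda>v :: real ^ 'n. v $ i) \<in> borel_measurable borel" for i
    by (intro borel_measurable_continuous_onI continuous_intros)
  obtain C where C: "C > 0" "\<And>v. norm v \<le> C * dual_norm N v"
    using norm_le_is_norm[OF dual_norm_is_norm[OF N]] by blast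
  obtain C' where C': "C' > 0" "\<And>v. norm v \<le> C' * N v" using norm_le_is_norm[OF N] by blast
  have "integrable M (\<lambda>\<omega>. (x t \<omega> - xs) $ i * gt t \<omega> $ i)" for i
  proof (rule integrable_mult_of_squares)
    show "(\<lambda>\<omega>. (x t \<omega> - xs) $ i) \<in> borel_measurable M" "(\<lambda>\<omega>. gt t \<omega> $ i) \<in> borel_measurable M"
      by measurable
    show "integrable M (\<lambda>\<omega>. ((x t \<omega> - xs) $ i)\<^sup>2)"
    proof (rule integrable_const_bound)
      have "\<bar>(x t \<omega> - xs) $ i\<bar> \<le> C' * D" if "\<omega> \<in> space M" for \<omega>
        using component_le_norm_cart[of "x t \<omega> - xs" i] C'(2)[of "x t \<omega> - xs"]
          mult_left_mono[OF N_x_le[OF t that], of C'] C'(1) by linarith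
      then have "\<bar>(x t \<omega> - xs) $ i\<bar>\<^sup>2 \<le> (C' * D)\<^sup>2" if "\<omega> \<in> space M" for \<omega>
        using that by (intro power_mono) auto
      then show "AE \<omega> in M. norm (((x t \<omega> - xs) $ i)\<^sup>2) \<le> (C' * D)\<^sup>2" by (intro AE_I2) simp
    qed measurable
    show "integrable M (\<lambda>\<omega>. (gt t \<omega> $ i)\<^sup>2)"
    proof (rule Bochner_Integration.integrable_bound)
      show "integrable M (\<lambda>\<omega>. C\<^sup>2 * (dual_norm N (gt t \<omega>))\<^sup>2)" using gt_second_moment[OF t] by simp
      have "\<bar>gt t \<omega> $ i\<bar>\<^sup>2 \<le> (C * dual_norm N (gt t \<omega>))\<^sup>2" for \<omega>
        using component_le_norm_cart[of "gt t \<omega>" i] C(2)[of "gt t \<omega>"] by (intro power_mono) auto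
      then show "AE \<omega> in M. norm ((gt t \<omega> $ i)\<^sup>2) \<le> norm (C\<^sup>2 * (dual_norm N (gt t \<omega>))\<^sup>2)"
        by (intro AE_I2) (simp add: power_mult_distrib)
    qed measurable
  qed
  then have "AE \<omega> in M. predicted_gain t \<omega> = vec_cond_exp M (F t) (gt t) \<omega> \<bullet> (x t \<omega> - xs)"
    unfolding predicted_gain_def gain_def
    by (intro real_cond_exp_inner[OF F_subalgebra, where h = "\<lambda>\<omega>. x t \<omega> - xs"]) auto
  with mean[OF t] show ?thesis by eventually_elim simp
qed

text \<open>
  The subgradient inequality bounds the suboptimality by \<open>\<langle>g(t), x(t) - x\<^sub>*\<rangle>\<close>; the bias, which is
  also contained in the predicted gain, costs at most \<open>B(t) D\<close>.
\<close>
lemma suboptimality_le_predicted_gain: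
  assumes t: "1 \<le> t"
  shows "AE \<omega> in M. f (x t \<omega>) - f xs \<le> predicted_gain t \<omega> + B t * D"
  using predicted_gain_eq[OF t] subgradient[OF t] bias[OF t] AE_space
proof eventually_elim
  case (elim \<omega>)
  have "f (x t \<omega>) + g t \<omega> \<bullet> (xs - x t \<omega>) \<le> f xs"
    using elim(2) unfolding subdifferential_def by blast
  moreover have "- (b t \<omega> \<bullet> (x t \<omega> - xs)) \<le> dual_norm N (b t \<omega>) * N (x t \<omega> - xs)"
    using abs_inner_le_dual_norm[OF N, of "b t \<omega>" "x t \<omega> - xs"] by linarith
  moreover have "\<dots> \<le> B t * D"
    using elim N_x_le[OF t] B_nonneg[OF t] is_norm_nonneg[OF N] by (intro mult_mono) auto
  ultimately show ?case using elim(1) by (simp add: inner_add_left inner_diff_right)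
qed

text \<open>
  The noise is \<open>\<langle>gt(t) - g(t) - b(t), x(t) - x\<^sub>*\<rangle>\<close>; the constant \<open>\<kappa>\<close> splits the squared dual norm
  of the three-term vector.
\<close>
lemma noise_second_moment:
  assumes t: "1 \<le> t"
  shows "integrable M (\<lambda>\<omega>. (gain t \<omega> - predicted_gain t \<omega>)\<^sup>2)"
    and "expectation (\<lambda>\<omega>. (gain t \<omega> - predicted_gain t \<omega>)\<^sup>2) \<le> D\<^sup>2 * \<kappa> * (\<nu>\<^sup>2 + G\<^sup>2 + (B t)\<^sup>2)"
proof -
  note [measurable] = gain_measurable[OF t]
  let ?bound = "\<lambda>\<omega>. D\<^sup>2 * \<kappa> * ((dual_norm N (gt t \<omega>))\<^sup>2 + G\<^sup>2 + (B t)\<^sup>2)"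
  have le: "AE \<omega> in M. (gain t \<omega> - predicted_gain t \<omega>)\<^sup>2 \<le> ?bound \<omega>"
    using predicted_gain_eq[OF t] subgradient[OF t] bias[OF t] AE_space
  proof eventually_elim
    case (elim \<omega>)
    have G: "(dual_norm N (g t \<omega>))\<^sup>2 \<le> G\<^sup>2"
      using subgradient_bound[OF x_mem[OF t elim(4)] elim(2)] by (intro power_mono dual_norm_nonneg[OF N])
    have B: "(dual_norm N (b t \<omega>))\<^sup>2 \<le> (B t)\<^sup>2"
      using elim(3) by (intro power_mono dual_norm_nonneg[OF N])
    have "gain t \<omega> - predicted_gain t \<omega> = (gt t \<omega> + - g t \<omega> + - b t \<omega>) \<bullet> (x t \<omega> - xs)"
      using elim(1) unfolding gain_def by (simp add: algebra_simps)
    then have "(gain t \<omega> - predicted_gain t \<omega>)\<^sup>2 \<le> D\<^sup>2 * (dual_norm N (gt t \<omega> + - g t \<omega> + - b t \<omega>))\<^sup>2"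
      using inner_sq_le[OF t elim(4)] by metis
    also have "\<dots> \<le> D\<^sup>2 * (\<kappa> * ((dual_norm N (gt t \<omega>))\<^sup>2 + (dual_norm N (- g t \<omega>))\<^sup>2 + (dual_norm N (- b t \<omega>))\<^sup>2))"
      by (intro mult_left_mono \<kappa>) simp
    also have "\<dots> \<le> D\<^sup>2 * (\<kappa> * ((dual_norm N (gt t \<omega>))\<^sup>2 + G\<^sup>2 + (B t)\<^sup>2))"
      using G B \<kappa>_pos by (intro mult_left_mono add_mono) (auto simp: dual_norm_minus[OF N])
    finally show ?case by (simp add: mult.assoc)
  qed
  have bint: "integrable M ?bound" using gt_second_moment[OF t] by simp
  show int: "integrable M (\<lambda>\<omega>. (gain t \<omega> - predicted_gain t \<omega>)\<^sup>2)"
  proof (rule Bochner_Integration.integrable_bound[OF bint])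
    show "AE \<omega> in M. norm ((gain t \<omega> - predicted_gain t \<omega>)\<^sup>2) \<le> norm (?bound \<omega>)"
      using le by eventually_elim simp
  qed measurable
  have "expectation (\<lambda>\<omega>. (gain t \<omega> - predicted_gain t \<omega>)\<^sup>2) \<le> expectation ?bound"
    by (rule integral_mono_AE[OF int bint le])
  also have "\<dots> = D\<^sup>2 * \<kappa> * (expectation (\<lambda>\<omega>. (dual_norm N (gt t \<omega>))\<^sup>2) + G\<^sup>2 + (B t)\<^sup>2)"
    using gt_second_moment[OF t] by (simp add: prob_space)
  also have "\<dots> \<le> D\<^sup>2 * \<kappa> * (\<nu>\<^sup>2 + G\<^sup>2 + (B t)\<^sup>2)"
    using gt_second_moment[OF t] \<kappa>_pos by (intro mult_left_mono) auto
  finally show "expectation (\<lambda>\<omega>. (gain t \<omega> - predicted_gain t \<omega>)\<^sup>2) \<le> D\<^sup>2 * \<kappa> * (\<nu>\<^sup>2 + G\<^sup>2 + (B t)\<^sup>2)" .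
qed

lemma noise_mean:
  assumes t: "1 \<le> t"
  shows "AE \<omega> in M. real_cond_exp M (F t) (\<lambda>\<omega>. gain t \<omega> - predicted_gain t \<omega>) \<omega> = 0"
proof -
  interpret Ft: sigma_finite_subalgebra M "F t" by (rule F_sigma_finite)
  show ?thesis
    using Ft.real_cond_exp_diff[OF gain_integrable[OF t] predicted_gain_integrable[OF t]]
      Ft.real_cond_exp_F_meas[OF predicted_gain_integrable[OF t] predicted_gain_F_measurable]
    by eventually_elim (simp add: predicted_gain_def)
qed

lemma visible_noise_second_moment:
  "integrable M (\<lambda>\<omega>. (\<Sum>k=1..t. \<alpha> k * visible_noise k \<omega>)\<^sup>2)"
  "expectation (\<lambda>\<omega>. (\<Sum>k=1..t. \<alpha> k * visible_noise k \<omega>)\<^sup>2)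
    \<le> D\<^sup>2 * \<kappa> * (\<Sum>k=1..t. (\<alpha> k)\<^sup>2 * (\<nu>\<^sup>2 + G\<^sup>2 + (B k)\<^sup>2))"
proof -
  have noise: "integrable M (\<lambda>\<omega>. (visible_noise k \<omega>)\<^sup>2)"
    "expectation (\<lambda>\<omega>. (visible_noise k \<omega>)\<^sup>2) \<le> expectation (\<lambda>\<omega>. (gain k \<omega> - predicted_gain k \<omega>)\<^sup>2)"
    "AE \<omega> in M. real_cond_exp M (F k) (visible_noise k) \<omega> = 0" if k: "1 \<le> k" for k
    unfolding visible_noise_def
    using cond_exp_centered[OF F_subalgebra history_mono _ noise_second_moment(1)[OF k] noise_mean[OF k], of "Suc k"]
      gain_measurable[OF k] by auto
  have *: "integrable M (\<lambda>\<omega>. (\<Sum>k=1..t. \<alpha> k * visible_noise k \<omega>)\<^sup>2) \<and>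
    expectation (\<lambda>\<omega>. (\<Sum>k=1..t. \<alpha> k * visible_noise k \<omega>)\<^sup>2)
      = (\<Sum>k=1..t. (\<alpha> k)\<^sup>2 * expectation (\<lambda>\<omega>. (visible_noise k \<omega>)\<^sup>2))"
    by (rule martingale_difference_second_moment[of F])
      (use F_subalgebra history_mono noise in \<open>auto simp: visible_noise_def\<close>)
  then show "integrable M (\<lambda>\<omega>. (\<Sum>k=1..t. \<alpha> k * visible_noise k \<omega>)\<^sup>2)" by simp
  have "(\<Sum>k=1..t. (\<alpha> k)\<^sup>2 * expectation (\<lambda>\<omega>. (visible_noise k \<omega>)\<^sup>2))
      \<le> (\<Sum>k=1..t. (\<alpha> k)\<^sup>2 * (D\<^sup>2 * \<kappa> * (\<nu>\<^sup>2 + G\<^sup>2 + (B k)\<^sup>2)))"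
    using noise(2) noise_second_moment(2) by (intro sum_mono mult_left_mono) (force, simp)
  also have "\<dots> = D\<^sup>2 * \<kappa> * (\<Sum>k=1..t. (\<alpha> k)\<^sup>2 * (\<nu>\<^sup>2 + G\<^sup>2 + (B k)\<^sup>2))"
    by (simp add: sum_distrib_left mult_ac)
  finally show "expectation (\<lambda>\<omega>. (\<Sum>k=1..t. \<alpha> k * visible_noise k \<omega>)\<^sup>2)
    \<le> D\<^sup>2 * \<kappa> * (\<Sum>k=1..t. (\<alpha> k)\<^sup>2 * (\<nu>\<^sup>2 + G\<^sup>2 + (B k)\<^sup>2))" using * by simp
qed

lemma visible_moment_expectation:
  "integrable M (\<lambda>\<omega>. \<Sum>k=1..t. (\<alpha> k)\<^sup>2 / (2 * \<sigma>) * visible_moment k \<omega>)"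
  "expectation (\<lambda>\<omega>. \<Sum>k=1..t. (\<alpha> k)\<^sup>2 / (2 * \<sigma>) * visible_moment k \<omega>) \<le> \<nu>\<^sup>2 * (\<Sum>k=1..t. (\<alpha> k)\<^sup>2) / (2 * \<sigma>)"
  "AE \<omega> in M. 0 \<le> (\<Sum>k=1..t. (\<alpha> k)\<^sup>2 / (2 * \<sigma>) * visible_moment k \<omega>)"
proof -
  have moment: "integrable M (visible_moment k)" "expectation (visible_moment k) \<le> \<nu>\<^sup>2"
    "AE \<omega> in M. 0 \<le> visible_moment k \<omega>" if k: "1 \<le> k" for k
  proof -
    interpret sigma_finite_subalgebra M "F (Suc k)" by (rule F_sigma_finite)
    show "integrable M (visible_moment k)" "expectation (visible_moment k) \<le> \<nu>\<^sup>2"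
      "AE \<omega> in M. 0 \<le> visible_moment k \<omega>"
      using real_cond_exp_int[OF gt_second_moment(1)[OF k]] gt_second_moment[OF k]
      unfolding visible_moment_def by (auto intro!: real_cond_exp_pos)
  qed
  show int: "integrable M (\<lambda>\<omega>. \<Sum>k=1..t. (\<alpha> k)\<^sup>2 / (2 * \<sigma>) * visible_moment k \<omega>)"
    using moment by (intro Bochner_Integration.integrable_sum) auto
  have "expectation (\<lambda>\<omega>. \<Sum>k=1..t. (\<alpha> k)\<^sup>2 / (2 * \<sigma>) * visible_moment k \<omega>)
      = (\<Sum>k=1..t. (\<alpha> k)\<^sup>2 / (2 * \<sigma>) * expectation (visible_moment k))"
    using moment by (subst Bochner_Integration.integral_sum) auto
  also have "\<dots> \<le> (\<Sum>k=1..t. (\<alpha> k)\<^sup>2 / (2 * \<sigma>) * \<nu>\<^sup>2)"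
    using moment \<sigma> by (intro sum_mono mult_left_mono) auto
  also have "\<dots> = \<nu>\<^sup>2 * (\<Sum>k=1..t. (\<alpha> k)\<^sup>2) / (2 * \<sigma>)"
    by (simp add: sum_distrib_left sum_divide_distrib mult_ac)
  finally show "expectation (\<lambda>\<omega>. \<Sum>k=1..t. (\<alpha> k)\<^sup>2 / (2 * \<sigma>) * visible_moment k \<omega>)
    \<le> \<nu>\<^sup>2 * (\<Sum>k=1..t. (\<alpha> k)\<^sup>2) / (2 * \<sigma>)" .
  have "AE \<omega> in M. \<forall>k\<in>{1..t}. 0 \<le> visible_moment k \<omega>"
    using moment(3) by (intro AE_finite_allI) auto
  then show "AE \<omega> in M. 0 \<le> (\<Sum>k=1..t. (\<alpha> k)\<^sup>2 / (2 * \<sigma>) * visible_moment k \<omega>)"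
    by eventually_elim (use \<sigma> in \<open>auto intro!: sum_nonneg\<close>)
qed

text \<open>
  Conditioning \<open>mirror_step_descent\<close> on the history at time \<open>t + 1\<close>.  Both divergences are
  known then, and they are bounded, so they are not changed; the gain becomes its predicted part plus
  the visible noise.
\<close>
lemma visible_descent:
  assumes t: "1 \<le> t"
  shows "AE \<omega> in M. \<alpha> t * (predicted_gain t \<omega> + visible_noise t \<omega>)
    \<le> bregman R xs (x t \<omega>) - bregman R xs (x (Suc t) \<omega>) + (\<alpha> t)\<^sup>2 / (2 * \<sigma>) * visible_moment t \<omega>"
proof -
  let ?G = "F (Suc t)"
  interpret G: sigma_finite_subalgebra M ?G by (rule F_sigma_finite)
  let ?V = "\<lambda>\<omega>. bregman R xs (x t \<omega>) - bregman R xs (x (Suc t) \<omega>)"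
  let ?Y = "\<lambda>\<omega>. (\<alpha> t)\<^sup>2 / (2 * \<sigma>) * (dual_norm N (gt t \<omega>))\<^sup>2"
  note Yint = gt_second_moment(1)[OF t] and gint = gain_integrable[OF t] and pint = predicted_gain_integrable[OF t]
  obtain C where C: "\<forall>y\<in>X. bregman R xs y \<le> C" using bregman_bounded[OF xs] by blast
  have "(\<lambda>\<omega>. bregman R xs (x s \<omega>)) \<in> borel_measurable ?G" if "s \<in> {t, Suc t}" for s
    by (rule bregman_measurable) (use that t x_mem in \<open>auto intro!: x_F_measurable\<close>)
  then have VG: "?V \<in> borel_measurable ?G" by (intro borel_measurable_diff) auto
  have "\<bar>?V \<omega>\<bar> \<le> C" if \<omega>: "\<omega> \<in> space M" for \<omega>
  proof -
    have "x t \<omega> \<in> X" "x (Suc t) \<omega> \<in> X" using x_mem \<omega> t by auto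
    then show ?thesis
      using bspec[OF C, of "x t \<omega>"] bspec[OF C, of "x (Suc t) \<omega>"] bregman_nonneg[OF xs, of "x t \<omega>"]
        bregman_nonneg[OF xs, of "x (Suc t) \<omega>"] by linarith
  qed
  then have Vint: "integrable M ?V"
    using measurable_from_subalg[OF F_subalgebra VG] by (intro integrable_const_bound[of _ C]) auto
  have "AE \<omega> in M. \<alpha> t * gain t \<omega> \<le> ?V \<omega> + ?Y \<omega>"
    using mirror_step_descent[OF x_mem \<alpha>_pos iterates xs] t unfolding gain_def by (intro AE_I2) blast
  then have "AE \<omega> in M. real_cond_exp M ?G (\<lambda>\<omega>. \<alpha> t * gain t \<omega>) \<omega> \<le> real_cond_exp M ?G (\<lambda>\<omega>. ?V \<omega> + ?Y \<omega>) \<omega>"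
    using Vint Yint gint by (intro G.real_cond_exp_mono) auto
  moreover have "AE \<omega> in M. real_cond_exp M ?G (\<lambda>\<omega>. \<alpha> t * gain t \<omega>) \<omega> = \<alpha> t * real_cond_exp M ?G (gain t) \<omega>"
    by (rule G.real_cond_exp_cmult[OF gint])
  moreover have "AE \<omega> in M. real_cond_exp M ?G (\<lambda>\<omega>. ?V \<omega> + ?Y \<omega>) \<omega>
      = real_cond_exp M ?G ?V \<omega> + real_cond_exp M ?G ?Y \<omega>"
    using Vint Yint by (intro G.real_cond_exp_add) auto
  moreover have "AE \<omega> in M. real_cond_exp M ?G ?V \<omega> = ?V \<omega>"
    by (rule G.real_cond_exp_F_meas[OF Vint VG])
  moreover have "AE \<omega> in M. real_cond_exp M ?G ?Y \<omega> = (\<alpha> t)\<^sup>2 / (2 * \<sigma>) * visible_moment t \<omega>"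
    unfolding visible_moment_def by (rule G.real_cond_exp_cmult[OF Yint])
  moreover have "AE \<omega> in M. visible_noise t \<omega> = real_cond_exp M ?G (gain t) \<omega> - real_cond_exp M ?G (predicted_gain t) \<omega>"
    unfolding visible_noise_def by (rule G.real_cond_exp_diff[OF gint pint])
  moreover have "AE \<omega> in M. real_cond_exp M ?G (predicted_gain t) \<omega> = predicted_gain t \<omega>"
    by (rule G.real_cond_exp_F_meas[OF pint measurable_from_subalg[OF history_mono predicted_gain_F_measurable]]) simp
  ultimately show ?thesis by eventually_elim simp
qed

text \<open>
  Jensen's inequality passes from the average iterate to the average of the values; then sum
  \<open>visible_descent\<close>, where the divergences telescope.
\<close>
lemma average_suboptimality_le:
  assumes t: "1 \<le> t" and C: "\<forall>y\<in>X. bregman R xs y \<le> C"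
  shows "AE \<omega> in M. (\<Sum>k=1..t. \<alpha> k) * (f (weighted_average \<alpha> x t \<omega>) - f xs)
    \<le> C + D * (\<Sum>k=1..t. \<alpha> k * B k) + (\<Sum>k=1..t. (\<alpha> k)\<^sup>2 / (2 * \<sigma>) * visible_moment k \<omega>)
      - (\<Sum>k=1..t. \<alpha> k * visible_noise k \<omega>)"
proof -
  define A where "A = (\<Sum>k=1..t. \<alpha> k)"
  have A: "A > 0" unfolding A_def using \<alpha>_pos t by (intro sum_pos) auto
  have "AE \<omega> in M. \<forall>k\<in>{1..t}. \<alpha> k * (predicted_gain k \<omega> + visible_noise k \<omega>)
    \<le> bregman R xs (x k \<omega>) - bregman R xs (x (Suc k) \<omega>) + (\<alpha> k)\<^sup>2 / (2 * \<sigma>) * visible_moment k \<omega>"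
    using visible_descent by (intro AE_finite_allI) auto
  moreover have "AE \<omega> in M. \<forall>k\<in>{1..t}. f (x k \<omega>) - f xs \<le> predicted_gain k \<omega> + B k * D"
    using suboptimality_le_predicted_gain by (intro AE_finite_allI) auto
  ultimately show ?thesis using AE_space
  proof eventually_elim
    case (elim \<omega>)
    have avg: "weighted_average \<alpha> x t \<omega> = (\<Sum>k=1..t. (\<alpha> k / A) *\<^sub>R x k \<omega>)"
      unfolding weighted_average_def A_def by (simp add: scaleR_sum_right divide_inverse mult.commute)
    have "f (\<Sum>k=1..t. (\<alpha> k / A) *\<^sub>R x k \<omega>) \<le> (\<Sum>k=1..t. \<alpha> k / A * f (x k \<omega>))"
      using A \<alpha>_pos t
      by (intro convex_on_sum[OF _ _ f_convex]) (auto simp: sum_divide_distrib[symmetric] A_def less_imp_le)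
    then have "A * f (weighted_average \<alpha> x t \<omega>) \<le> A * (\<Sum>k=1..t. \<alpha> k / A * f (x k \<omega>))"
      unfolding avg using A by (intro mult_left_mono) auto
    also have "\<dots> = (\<Sum>k=1..t. \<alpha> k * f (x k \<omega>))" using A by (simp add: sum_distrib_left)
    finally have "A * (f (weighted_average \<alpha> x t \<omega>) - f xs) \<le> (\<Sum>k=1..t. \<alpha> k * (f (x k \<omega>) - f xs))"
      by (simp add: right_diff_distrib sum_subtractf sum_distrib_right A_def)
    also have "\<dots> \<le> (\<Sum>k=1..t. (bregman R xs (x k \<omega>) - bregman R xs (x (Suc k) \<omega>))
        + D * (\<alpha> k * B k) + (\<alpha> k)\<^sup>2 / (2 * \<sigma>) * visible_moment k \<omega> - \<alpha> k * visible_noise k \<omega>)"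
    proof (rule sum_mono)
      fix k assume k: "k \<in> {1..t}"
      have "\<alpha> k * (f (x k \<omega>) - f xs) \<le> \<alpha> k * (predicted_gain k \<omega> + B k * D)"
        using elim(2) k \<alpha>_pos by (intro mult_left_mono) (auto simp: less_imp_le)
      also have "\<dots> = \<alpha> k * (predicted_gain k \<omega> + visible_noise k \<omega>) + D * (\<alpha> k * B k) - \<alpha> k * visible_noise k \<omega>"
        by (simp add: algebra_simps)
      finally show "\<alpha> k * (f (x k \<omega>) - f xs) \<le> (bregman R xs (x k \<omega>) - bregman R xs (x (Suc k) \<omega>))
        + D * (\<alpha> k * B k) + (\<alpha> k)\<^sup>2 / (2 * \<sigma>) * visible_moment k \<omega> - \<alpha> k * visible_noise k \<omega>"
        using elim(1) k by fastforce
    qed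
    also have "\<dots> = (\<Sum>k=1..t. bregman R xs (x k \<omega>) - bregman R xs (x (Suc k) \<omega>))
        + D * (\<Sum>k=1..t. \<alpha> k * B k) + (\<Sum>k=1..t. (\<alpha> k)\<^sup>2 / (2 * \<sigma>) * visible_moment k \<omega>)
        - (\<Sum>k=1..t. \<alpha> k * visible_noise k \<omega>)"
      by (simp add: sum.distrib sum_subtractf sum_distrib_left)
    also have "(\<Sum>k=1..t. bregman R xs (x k \<omega>) - bregman R xs (x (Suc k) \<omega>))
        = bregman R xs (x 1 \<omega>) - bregman R xs (x (Suc t) \<omega>)"
      using sum_Suc_diff[of 1 "Suc t" "\<lambda>k. - bregman R xs (x k \<omega>)"] t by simp
    also have "\<dots> \<le> C"
      using bspec[OF C x_mem[of 1 \<omega>]] bregman_nonneg[OF xs x_mem[of "Suc t" \<omega>]] elim(3) by simp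
    finally show ?case unfolding A_def by simp
  qed
qed

text \<open>
  When the deterministic part of \<open>average_suboptimality_le\<close> is at most a third of \<open>\<epsilon> A\<^sub>t\<close>, the second
  moments or the noise have to make up another third.
\<close>
lemma tail_bound:
  assumes t: "1 \<le> t" and \<epsilon>: "\<epsilon> > 0" and C: "\<forall>y\<in>X. bregman R xs y \<le> C"
    and large: "3 * (C + D * (\<Sum>k=1..t. \<alpha> k * B k)) \<le> \<epsilon> * (\<Sum>k=1..t. \<alpha> k)"
  shows "measure M {\<omega> \<in> space M. f (weighted_average \<alpha> x t \<omega>) - f xs \<ge> \<epsilon>}
    \<le> 3 * \<nu>\<^sup>2 * (\<Sum>k=1..t. (\<alpha> k)\<^sup>2) / (2 * \<sigma> * \<epsilon> * (\<Sum>k=1..t. \<alpha> k))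
      + 9 * D\<^sup>2 * \<kappa> * (\<Sum>k=1..t. (\<alpha> k)\<^sup>2 * (\<nu>\<^sup>2 + G\<^sup>2 + (B k)\<^sup>2)) / (\<epsilon>\<^sup>2 * (\<Sum>k=1..t. \<alpha> k)\<^sup>2)"
proof -
  define A where "A = (\<Sum>k=1..t. \<alpha> k)"
  define c where "c = \<epsilon> * A / 3"
  define S1 where "S1 = (\<lambda>\<omega>. \<Sum>k=1..t. (\<alpha> k)\<^sup>2 / (2 * \<sigma>) * visible_moment k \<omega>)"
  define S2 where "S2 = (\<lambda>\<omega>. \<Sum>k=1..t. \<alpha> k * visible_noise k \<omega>)"
  have A: "A > 0" unfolding A_def using \<alpha>_pos t by (intro sum_pos) auto
  have c: "c > 0" unfolding c_def using A \<epsilon> by simp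
  have S1: "integrable M S1" "expectation S1 \<le> \<nu>\<^sup>2 * (\<Sum>k=1..t. (\<alpha> k)\<^sup>2) / (2 * \<sigma>)" "AE \<omega> in M. 0 \<le> S1 \<omega>"
    unfolding S1_def by (fact visible_moment_expectation)+
  have S2: "integrable M (\<lambda>\<omega>. (S2 \<omega>)\<^sup>2)"
    "expectation (\<lambda>\<omega>. (S2 \<omega>)\<^sup>2) \<le> D\<^sup>2 * \<kappa> * (\<Sum>k=1..t. (\<alpha> k)\<^sup>2 * (\<nu>\<^sup>2 + G\<^sup>2 + (B k)\<^sup>2))"
    unfolding S2_def by (fact visible_noise_second_moment)+
  note [measurable] = borel_measurable_integrable[OF S1(1)]
  have [measurable]: "S2 \<in> borel_measurable M" unfolding S2_def visible_noise_def by measurable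
  \<comment> \<open>Using the square of \<open>S2\<close> turns Chebyshev's inequality into an instance of Markov's.\<close>
  let ?E1 = "{\<omega> \<in> space M. S1 \<omega> \<ge> c}" and ?E2 = "{\<omega> \<in> space M. (S2 \<omega>)\<^sup>2 \<ge> c\<^sup>2}"
  have "AE \<omega> in M. \<omega> \<in> {\<omega> \<in> space M. f (weighted_average \<alpha> x t \<omega>) - f xs \<ge> \<epsilon>} \<longrightarrow> \<omega> \<in> ?E1 \<union> ?E2"
    using average_suboptimality_le[OF t C]
  proof eventually_elim
    case (elim \<omega>)
    show ?case
    proof
      assume \<omega>: "\<omega> \<in> {\<omega> \<in> space M. f (weighted_average \<alpha> x t \<omega>) - f xs \<ge> \<epsilon>}"
      then have "A * \<epsilon> \<le> A * (f (weighted_average \<alpha> x t \<omega>) - f xs)" using A by (intro mult_left_mono) auto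
      also have "\<dots> \<le> C + D * (\<Sum>k=1..t. \<alpha> k * B k) + S1 \<omega> - S2 \<omega>"
        using elim unfolding A_def S1_def S2_def .
      also have "\<dots> \<le> c + S1 \<omega> - S2 \<omega>"
        using large unfolding c_def A_def by simp
      finally have "c \<le> S1 \<omega> \<or> c \<le> \<bar>S2 \<omega>\<bar>" unfolding c_def by (simp add: mult.commute) linarith
      moreover have "c\<^sup>2 \<le> (S2 \<omega>)\<^sup>2" if "c \<le> \<bar>S2 \<omega>\<bar>" using power_mono[OF that, of 2] c by simp
      ultimately show "\<omega> \<in> ?E1 \<union> ?E2" using \<omega> by auto
    qed
  qed
  then have "measure M {\<omega> \<in> space M. f (weighted_average \<alpha> x t \<omega>) - f xs \<ge> \<epsilon>} \<le> measure M (?E1 \<union> ?E2)"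
    by (rule finite_measure_mono_AE) measurable
  also have "\<dots> \<le> measure M ?E1 + measure M ?E2"
    by (rule measure_Un_le) measurable
  also have "\<dots> \<le> expectation S1 / c + expectation (\<lambda>\<omega>. (S2 \<omega>)\<^sup>2) / c\<^sup>2"
    using c by (intro add_mono integral_Markov_inequality_measure[where A = "{}"] S1(1,3) S2(1)) auto
  also have "\<dots> \<le> (\<nu>\<^sup>2 * (\<Sum>k=1..t. (\<alpha> k)\<^sup>2) / (2 * \<sigma>)) / c
      + (D\<^sup>2 * \<kappa> * (\<Sum>k=1..t. (\<alpha> k)\<^sup>2 * (\<nu>\<^sup>2 + G\<^sup>2 + (B k)\<^sup>2))) / c\<^sup>2"
    using c by (intro add_mono divide_right_mono S1 S2) auto
  also have "\<dots> = 3 * \<nu>\<^sup>2 * (\<Sum>k=1..t. (\<alpha> k)\<^sup>2) / (2 * \<sigma> * \<epsilon> * A)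
      + 9 * D\<^sup>2 * \<kappa> * (\<Sum>k=1..t. (\<alpha> k)\<^sup>2 * (\<nu>\<^sup>2 + G\<^sup>2 + (B k)\<^sup>2)) / (\<epsilon>\<^sup>2 * A\<^sup>2)"
    unfolding c_def using A \<epsilon> \<sigma> by (simp add: power_divide power_mult_distrib mult_ac)
  finally show ?thesis unfolding A_def .
qed

end

end

theorem theorem4:
  fixes M :: "'w measure"
    and N :: "real ^ 'n \<Rightarrow> real"
    and X U :: "(real ^ 'n) set"
    and f R :: "real ^ 'n \<Rightarrow> real"
    and x gt g b :: "nat \<Rightarrow> 'w \<Rightarrow> real ^ 'n"
    and \<alpha> B :: "nat \<Rightarrow> real"
    and \<sigma> \<nu> G \<kappa> :: real
  assumes "prob_space M"
    and "is_norm N"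
    and "X \<noteq> {}" and "convex X" and "compact X"
    and "convex_on UNIV f" and "continuous_on UNIV f"
    and "G > 0" and "\<forall>y\<in>X. \<forall>h\<in>subdifferential f y. dual_norm N h \<le> G"
    and "\<sigma> > 0" and "open U" and "X \<subseteq> U"
    and "strongly_convex_on N \<sigma> U R" and "\<forall>y\<in>U. R differentiable (at y)"
    and "\<kappa> > 0"
    and "\<forall>u v w. (dual_norm N (u + v + w))\<^sup>2
           \<le> \<kappa> * ((dual_norm N u)\<^sup>2 + (dual_norm N v)\<^sup>2 + (dual_norm N w)\<^sup>2)"
    and "x 1 \<in> borel_measurable M" and "\<forall>\<omega>\<in>space M. x 1 \<omega> \<in> X"
    and "\<forall>t\<ge>1. \<alpha> t > 0"
    and "\<forall>t\<ge>1. gt t \<in> borel_measurable M"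
    and iterates: "\<forall>t\<ge>1. \<forall>\<omega>\<in>space M.
           is_arg_min (\<lambda>y. gt t \<omega> \<bullet> (y - x t \<omega>) + 1 / \<alpha> t * bregman R y (x t \<omega>))
             (\<lambda>y. y \<in> X) (x (t + 1) \<omega>)"
    and A1_mean: "\<forall>t\<ge>1. AE \<omega> in M. vec_cond_exp M (history M x t) (gt t) \<omega> = g t \<omega> + b t \<omega>"
    and A1_subgradient: "\<forall>t\<ge>1. AE \<omega> in M. g t \<omega> \<in> subdifferential f (x t \<omega>)"
    and A1_bias: "\<forall>t\<ge>1. b t \<in> borel_measurable (history M x t)"
    and A1_moment: "\<forall>t\<ge>1. cond_second_moment_le M (history M x t) (dual_norm N) (gt t) (\<nu>\<^sup>2)"
    and A2: "filterlim (\<lambda>t. \<Sum>k=1..t. \<alpha> k) at_top sequentially"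
            "summable (\<lambda>k. (\<alpha> (Suc k))\<^sup>2)"
    and A3: "\<forall>t\<ge>1. B t \<ge> 0"
            "\<forall>t\<ge>1. AE \<omega> in M. dual_norm N (b t \<omega>) \<le> B t"
            "summable (\<lambda>k. \<alpha> (Suc k) * B (Suc k))"
  defines "D \<equiv> norm_diameter N X"
    and "K \<equiv> exp (- (\<Sum>k. 2 * \<alpha> (Suc k) * B (Suc k) / \<sigma>))"
    and "fstar \<equiv> (INF y\<in>X. f y)"
  shows "\<forall>\<epsilon>>0. \<exists>t0. \<forall>t\<ge>t0.
           measure M {\<omega> \<in> space M. f (weighted_average \<alpha> x t \<omega>) - fstar \<ge> \<epsilon>}
             \<le> 3 * \<nu>\<^sup>2 * (\<Sum>k=1..t. (\<alpha> k)\<^sup>2) / (2 * \<sigma> * \<epsilon> * K * (\<Sum>k=1..t. \<alpha> k))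
               + 9 * D\<^sup>2 * \<kappa> * (\<Sum>k=1..t. (\<alpha> k)\<^sup>2 * (\<nu>\<^sup>2 + G\<^sup>2 + (B k)\<^sup>2))
                 / (\<epsilon>\<^sup>2 * K\<^sup>2 * (\<Sum>k=1..t. \<alpha> k)\<^sup>2)"
proof (intro allI impI)
  fix \<epsilon> :: real assume \<epsilon>: "\<epsilon> > 0"
  interpret prob_space M by fact
  interpret stochastic_mirror_descent N X U R \<sigma> M f x gt g b \<alpha> B \<nu> G \<kappa>
    by unfold_locales (use assms in auto)
  have "continuous_on X f" using \<open>continuous_on UNIV f\<close> by (rule continuous_on_subset) simp
  from continuous_attains_inf[OF \<open>compact X\<close> \<open>X \<noteq> {}\<close> this]
  obtain xs where xs: "xs \<in> X" "\<And>y. y \<in> X \<Longrightarrow> f xs \<le> f y" by auto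
  have fstar: "fstar = f xs"
    unfolding fstar_def using xs by (intro cInf_eq_minimum) auto
  obtain C where C: "\<forall>y\<in>X. bregman R xs y \<le> C" using bregman_bounded[OF xs(1)] by blast
  define S where "S = (\<Sum>k. \<alpha> (Suc k) * B (Suc k))"
  have D: "0 \<le> D" unfolding D_def by (rule D_nonneg[OF xs(1)])
  have \<alpha>B: "0 \<le> \<alpha> (Suc k) * B (Suc k)" for k
    using \<alpha>_pos[of "Suc k"] B_nonneg[of "Suc k"] by (simp add: less_imp_le)
  have partial: "(\<Sum>k=1..t. \<alpha> k * B k) \<le> S" for t
  proof -
    have "(\<Sum>k=1..t. \<alpha> k * B k) = (\<Sum>k<t. \<alpha> (Suc k) * B (Suc k))"
      by (simp add: sum.atLeast1_atMost_eq)
    also have "\<dots> \<le> S" unfolding S_def by (rule sum_le_suminf[OF A3(3)]) (use \<alpha>B in auto)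
    finally show ?thesis .
  qed
  have K: "0 < K" "K \<le> 1"
  proof -
    have "0 \<le> (\<Sum>k. 2 * \<alpha> (Suc k) * B (Suc k) / \<sigma>)"
    proof (rule suminf_nonneg)
      show "summable (\<lambda>k. 2 * \<alpha> (Suc k) * B (Suc k) / \<sigma>)"
        using summable_mult[OF A3(3), of "2 / \<sigma>"] by (simp add: mult_ac)
      show "0 \<le> 2 * \<alpha> (Suc k) * B (Suc k) / \<sigma>" for k
        using \<alpha>B[of k] \<open>\<sigma> > 0\<close> by (simp add: mult.assoc)
    qed
    then show "0 < K" "K \<le> 1" unfolding K_def by auto
  qed
  obtain t0 where t0: "\<And>t. t \<ge> t0 \<Longrightarrow> 3 * (C + D * S) / \<epsilon> \<le> (\<Sum>k=1..t. \<alpha> k)"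
    using A2(1) unfolding filterlim_at_top eventually_sequentially by blast
  show "\<exists>t0. \<forall>t\<ge>t0. measure M {\<omega> \<in> space M. f (weighted_average \<alpha> x t \<omega>) - fstar \<ge> \<epsilon>}
             \<le> 3 * \<nu>\<^sup>2 * (\<Sum>k=1..t. (\<alpha> k)\<^sup>2) / (2 * \<sigma> * \<epsilon> * K * (\<Sum>k=1..t. \<alpha> k))
               + 9 * D\<^sup>2 * \<kappa> * (\<Sum>k=1..t. (\<alpha> k)\<^sup>2 * (\<nu>\<^sup>2 + G\<^sup>2 + (B k)\<^sup>2))
                 / (\<epsilon>\<^sup>2 * K\<^sup>2 * (\<Sum>k=1..t. \<alpha> k)\<^sup>2)"
  \<comment> \<open>At \<open>t = 0\<close> the weights have sum \<open>0\<close> and the average is undefined, hence the maximum with \<open>1\<close>.\<close>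
  proof (intro exI[of _ "max 1 t0"] allI impI)
    fix t assume "max 1 t0 \<le> t"
    then have t: "1 \<le> t" "t0 \<le> t" by auto
    define A where "A = (\<Sum>k=1..t. \<alpha> k)"
    have A: "A > 0" unfolding A_def using \<alpha>_pos t by (intro sum_pos) auto
    let ?P = "3 * \<nu>\<^sup>2 * (\<Sum>k=1..t. (\<alpha> k)\<^sup>2)"
    let ?Q = "9 * D\<^sup>2 * \<kappa> * (\<Sum>k=1..t. (\<alpha> k)\<^sup>2 * (\<nu>\<^sup>2 + G\<^sup>2 + (B k)\<^sup>2))"
    have "3 * (C + D * (\<Sum>k=1..t. \<alpha> k * B k)) \<le> 3 * (C + D * S)"
      using mult_left_mono[OF partial D] by simp
    also have "\<dots> \<le> \<epsilon> * (\<Sum>k=1..t. \<alpha> k)"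
      using t0[OF t(2)] \<epsilon> by (simp add: pos_divide_le_eq mult.commute)
    finally have "measure M {\<omega> \<in> space M. f (weighted_average \<alpha> x t \<omega>) - fstar \<ge> \<epsilon>}
        \<le> ?P / (2 * \<sigma> * \<epsilon> * A) + ?Q / (\<epsilon>\<^sup>2 * A\<^sup>2)"
      using tail_bound[OF xs(1) t(1) \<epsilon> C] unfolding fstar D_def A_def by blast
    also have "\<dots> \<le> ?P / (2 * \<sigma> * \<epsilon> * K * A) + ?Q / (\<epsilon>\<^sup>2 * K\<^sup>2 * A\<^sup>2)"
    proof (intro add_mono divide_left_mono)
      show "2 * \<sigma> * \<epsilon> * K * A \<le> 2 * \<sigma> * \<epsilon> * A"
        using K A \<epsilon> \<open>\<sigma> > 0\<close> by (simp add: mult_left_le)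
      show "\<epsilon>\<^sup>2 * K\<^sup>2 * A\<^sup>2 \<le> \<epsilon>\<^sup>2 * A\<^sup>2"
        using K A \<epsilon> by (simp add: mult_left_le power_le_one)
      show "0 \<le> ?P" "0 \<le> ?Q" using \<open>\<kappa> > 0\<close> by (auto intro!: mult_nonneg_nonneg sum_nonneg)
      show "0 < 2 * \<sigma> * \<epsilon> * A * (2 * \<sigma> * \<epsilon> * K * A)" "0 < \<epsilon>\<^sup>2 * A\<^sup>2 * (\<epsilon>\<^sup>2 * K\<^sup>2 * A\<^sup>2)"
        using K A \<epsilon> \<open>\<sigma> > 0\<close> by auto
    qed
    finally show "measure M {\<omega> \<in> space M. f (weighted_average \<alpha> x t \<omega>) - fstar \<ge> \<epsilon>}
             \<le> 3 * \<nu>\<^sup>2 * (\<Sum>k=1..t. (\<alpha> k)\<^sup>2) / (2 * \<sigma> * \<epsilon> * K * (\<Sum>k=1..t. \<alpha> k))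
               + 9 * D\<^sup>2 * \<kappa> * (\<Sum>k=1..t. (\<alpha> k)\<^sup>2 * (\<nu>\<^sup>2 + G\<^sup>2 + (B k)\<^sup>2))
                 / (\<epsilon>\<^sup>2 * K\<^sup>2 * (\<Sum>k=1..t. \<alpha> k)\<^sup>2)" unfolding A_def .
  qed
qed

end
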